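(* Let $p\in[0,\tfrac12]$ be a computable real and $z\in 3^\omega$, and suppose $Q\in\mathcal{K}(2^\omega)$ is $\mu^*_p$-random relative to $z$. Then for every $n\geq 2$ there exist $P_1,\dots,P_n\in\mathcal{K}(2^\omega)$, each $\mu^*_{f_n^{-1}(p)}$-random relative to $z$, such that $Q=\bigcap_{i=1}^n P_i$, where $f_n^{-1}(p)=1-\sqrt[n]{1-p}$.
   Context: $\mathcal{K}(2^\omega)$ is the set of non-empty closed subsets of $2^\omega$. For $x\in 3^\omega$ the tree $T_x\subseteq 2^{<\omega}$ is defined inductively: $\epsilon\in T_x$; if $\sigma$ is the $(i+1)$-st node placed in $T_x$ (in length-lexicographic order), then only $\sigma0$ is added if $x(i)=0$, only $\sigma1$ if $x(i)=1$, both if $x(i)=2$. Each $C\in\mathcal{K}(2^\omega)$ has a unique code $x_C\in3^\omega$ with $[T_{x_C}]=C$. For $p\in[0,\tfrac12]$, $\mu_p$ is the Bernoulli measure on $3^\omega$ in which each symbol is independently $0$ with probability $p$, $1$ with probability $p$, $2$ with probability $1-2p$; $\mu^*_p$ is the induced measure on closed sets. $C$ is $\mu^*_p$-random relative to $z$ if $x_C$ is $\mu_p$-Martin-L\"of random relative to $z$. The function $f_n(p)=1-(1-p)^n$ has inverse $f_n^{-1}(p)=1-\sqrt[n]{1-p}$ on $[0,1-2^{-n}]$. *)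

theory Defs
  imports "HOL-Probability.Probability" "HOL-Library.Nat_Bijection"
begin

section \<open>Relative computability\<close>

text \<open>
  Total functions on the natural numbers that are computable from \<open>g\<close>: the general
  recursive functions relative to \<open>g\<close>, with pairs coded by \<^const>\<open>prod_encode\<close>, closed under
  primitive recursion and under minimization of regular functions (those for which a zero exists
  for every parameter).
\<close>

inductive computable_in :: "(nat \<Rightarrow> nat) \<Rightarrow> (nat \<Rightarrow> nat) \<Rightarrow> bool" for g :: "nat \<Rightarrow> nat" where
  zero: "computable_in g (\<lambda>_. 0)"
| succ: "computable_in g Suc"
| left: "computable_in g (\<lambda>a. fst (prod_decode a))"
| right: "computable_in g (\<lambda>a. snd (prod_decode a))"
| query: "computable_in g g"
| pair: "computable_in g f \<Longrightarrow> computable_in g h \<Longrightarrow> computable_in g (\<lambda>a. prod_encode (f a, h a))"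
| comp: "computable_in g f \<Longrightarrow> computable_in g h \<Longrightarrow> computable_in g (\<lambda>a. f (h a))"
| prec: "computable_in g f \<Longrightarrow> computable_in g h \<Longrightarrow>
    computable_in g (\<lambda>a. rec_nat (f (fst (prod_decode a)))
      (\<lambda>k r. h (prod_encode (fst (prod_decode a), prod_encode (k, r)))) (snd (prod_decode a)))"
| minim: "computable_in g f \<Longrightarrow> (\<And>a. \<exists>k. f (prod_encode (a, k)) = 0) \<Longrightarrow>
    computable_in g (\<lambda>a. LEAST k. f (prod_encode (a, k)) = 0)"

definition ce_in :: "(nat \<Rightarrow> nat) \<Rightarrow> nat set \<Rightarrow> bool" where
  "ce_in g W \<longleftrightarrow> W = {} \<or> (\<exists>f. computable_in g f \<and> W = range f)"

text \<open>Computability relative to \<open>\<lambda>_. 0\<close> is plain computability.\<close>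

definition computable_real :: "real \<Rightarrow> bool" where
  "computable_real r \<longleftrightarrow>
    (\<exists>a b. computable_in (\<lambda>_. 0) a \<and> computable_in (\<lambda>_. 0) b \<and>
      (\<forall>n. \<bar>r - real_of_int (int_decode (a n)) / real (Suc (b n))\<bar> \<le> 1 / 2 ^ n))"


section \<open>Ternary sequences and Martin-Loef randomness\<close>

datatype trit = T0 | T1 | T2

fun trit_code :: "trit \<Rightarrow> nat" where
  "trit_code T0 = 0"
| "trit_code T1 = 1"
| "trit_code T2 = 2"

text \<open>\<^const>\<open>embed_pmf\<close> is meaningful here only for \<open>0 \<le> p \<le> 1/2\<close>; see \<open>pmf_trit_pmf\<close>.\<close>

definition trit_pmf :: "real \<Rightarrow> trit pmf" where
  "trit_pmf p = embed_pmf (\<lambda>s. case s of T0 \<Rightarrow> p | T1 \<Rightarrow> p | T2 \<Rightarrow> 1 - 2 * p)"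

lemma pmf_trit_pmf:
  assumes "0 \<le> p" "p \<le> 1/2"
  shows "pmf (trit_pmf p) s = (case s of T0 \<Rightarrow> p | T1 \<Rightarrow> p | T2 \<Rightarrow> 1 - 2 * p)"
proof -
  have U: "(UNIV :: trit set) = {T0, T1, T2}"
    using trit.exhaust by auto
  have fin: "finite (UNIV :: trit set)"
    unfolding U by simp
  have "(\<integral>\<^sup>+s. ennreal (case s of T0 \<Rightarrow> p | T1 \<Rightarrow> p | T2 \<Rightarrow> 1 - 2 * p) \<partial>count_space UNIV) = 1"
    using assms by (subst nn_integral_count_space_finite[OF fin])
      (simp add: U ennreal_plus[symmetric] del: ennreal_plus)
  then show ?thesis
    unfolding trit_pmf_def using assms by (subst pmf_embed_pmf) (auto split: trit.split)
qed

definition bernoulli_measure :: "real \<Rightarrow> (nat \<Rightarrow> trit) measure" where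
  "bernoulli_measure p = PiM UNIV (\<lambda>_. measure_pmf (trit_pmf p))"

text \<open>
  A set \<open>W\<close> of numbers codes a sequence of open sets: the \<open>m\<close>-th one is the union of the cylinders
  \<open>[\<sigma>]\<close> over all strings \<open>\<sigma>\<close> such that the code of \<open>(m, \<sigma>)\<close> is in \<open>W\<close>.
\<close>

definition coded_open :: "nat set \<Rightarrow> nat \<Rightarrow> (nat \<Rightarrow> trit) set" where
  "coded_open W m =
    {x. \<exists>k. prod_encode (m, list_encode (map (\<lambda>i. trit_code (x i)) [0..<k])) \<in> W}"

definition martin_loef_test :: "real \<Rightarrow> (nat \<Rightarrow> trit) \<Rightarrow> (nat \<Rightarrow> (nat \<Rightarrow> trit) set) \<Rightarrow> bool" where
  "martin_loef_test p z U \<longleftrightarrow>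
    (\<exists>W. ce_in (\<lambda>i. trit_code (z i)) W \<and> U = coded_open W) \<and>
    (\<forall>m. measure (bernoulli_measure p) (U m) \<le> 1 / 2 ^ m)"

definition martin_loef_random :: "real \<Rightarrow> (nat \<Rightarrow> trit) \<Rightarrow> (nat \<Rightarrow> trit) \<Rightarrow> bool" where
  "martin_loef_random p z x \<longleftrightarrow> (\<forall>U. martin_loef_test p z U \<longrightarrow> x \<notin> (\<Inter>m. U m))"


section \<open>Codes of closed subsets of Cantor space\<close>

definition closed_subsets :: "(nat \<Rightarrow> bool) set set" where
  "closed_subsets = {C. closed C \<and> C \<noteq> {}}"

fun branches :: "trit \<Rightarrow> bool set" where
  "branches T0 = {False}"
| "branches T1 = {True}"
| "branches T2 = {False, True}"

text \<open>
  The nodes of length at most \<open>n\<close> of the tree coded by \<open>x\<close>. The node \<open>\<sigma>\<close> is the \<open>(i+1)\<close>-st node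
  when exactly \<open>i\<close> nodes precede it in the length-lexicographic order \<^term>\<open>lenlex {(False, True)}\<close>;
  as they are no longer than \<open>\<sigma>\<close>, it suffices to count those found so far.
\<close>

primrec tree_upto :: "(nat \<Rightarrow> trit) \<Rightarrow> nat \<Rightarrow> bool list set" where
  "tree_upto x 0 = {[]}"
| "tree_upto x (Suc n) = tree_upto x n \<union>
    {\<sigma> @ [b] | \<sigma> b. \<sigma> \<in> tree_upto x n \<and> length \<sigma> = n \<and>
      b \<in> branches (x (card {\<tau> \<in> tree_upto x n. (\<tau>, \<sigma>) \<in> lenlex {(False, True)}}))}"

definition tree :: "(nat \<Rightarrow> trit) \<Rightarrow> bool list set" where
  "tree x = (\<Union>n. tree_upto x n)"

definition paths :: "bool list set \<Rightarrow> (nat \<Rightarrow> bool) set" where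
  "paths T = {y. \<forall>n. map y [0..<n] \<in> T}"

definition code :: "(nat \<Rightarrow> bool) set \<Rightarrow> (nat \<Rightarrow> trit)" where
  "code C = (THE x. paths (tree x) = C)"

definition random_closed :: "real \<Rightarrow> (nat \<Rightarrow> trit) \<Rightarrow> (nat \<Rightarrow> bool) set \<Rightarrow> bool" where
  "random_closed p z C \<longleftrightarrow> C \<in> closed_subsets \<and> martin_loef_random p z (code C)"

end

(*
Given the code x of Q, a code y of a random superset of Q is produced by growing its tree breadth
first. With q = 1 - (1 - p)^(1/n), a node outside the tree of Q gets a symbol of law mu_q. A node
in the tree of Q repeats the symbol of x with probability q/p and is made fully branching
otherwise. If x has law mu_p then y has law mu_q, because p * (q/p) = q. Since 1/n <= q/p <= 1,
these choices can be coupled for n codes y_1, ..., y_n so that at each node of the tree of Q some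
y_i repeats the symbol of x, and then the intersection of the n trees is exactly the tree of Q.

For a mu_q-test U, let F_m(x) be the conditional probability that y lies in U_m. Its mu_p-mean is
at most 2^(-m), so {x. F_(2k)(x) > 2^(-k)} has mu_p-measure at most 2^(-k) by Markov's inequality.
These sets are uniformly c.e. open, because p is computable and only the first L symbols of x matter
for the first L symbols of y. So they form a mu_p-test, which a random x passes, and hence almost every
y avoids the intersection of the U_m. As there are only countably many tests, almost every choice
makes all y_i random at once.
*)

theory Submission
  imports Defs
begin

section \<open>Breadth-first enumeration of the nodes of a coded tree\<close>

text \<open>The obstacle is that Q is given: almost every pair of a code x and a choice giving a
  random y says nothing about this particular x. Its randomness must be spent on an effective
  statement, namely that its conditional probabilities are small. Hence these probabilities have to
  be enumerated from below by integer arithmetic, with p entering through rational bounds and the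
  root only through n-th powers. A node of the tree of x has different indices in the codes x and
  y_i, yet common nodes occur in all of them in the same order, because every tree is listed
  length-lexicographically. So x can be read one symbol at a time while y_i is written, and the
  coupled choices are indexed by the position in x, the one index that all y_i share. The bound 1/n
  <= q/p is Bernoulli's inequality for (1 - q)^n = 1 - p.\<close>

fun trit_branches :: "trit \<Rightarrow> bool list" where
  "trit_branches T0 = [False]"
| "trit_branches T1 = [True]"
| "trit_branches T2 = [False, True]"

lemma set_trit_branches [simp]: "set (trit_branches a) = branches a"
  by (cases a) auto

lemma trit_branches_not_Nil [simp]: "trit_branches a \<noteq> []"
  by (cases a) auto

lemma branches_inj: "branches a = branches b \<Longrightarrow> a = b"
  by (cases a; cases b) auto

lemma branches_surj: "B \<noteq> {} \<Longrightarrow> \<exists>a. branches a = B"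
proof -
  assume "B \<noteq> {}"
  then have "B = {False} \<or> B = {True} \<or> B = {False, True}"
    by (cases "True \<in> B"; cases "False \<in> B") (auto, (metis (full_types))+)
  then show ?thesis
    by (metis branches.simps)
qed

abbreviation node_less :: "bool list \<Rightarrow> bool list \<Rightarrow> bool" where
  "node_less \<sigma> \<tau> \<equiv> (\<sigma>, \<tau>) \<in> lenlex {(False, True)}"

lemma node_less_trans: "node_less a b \<Longrightarrow> node_less b c \<Longrightarrow> node_less a c"
  by (rule lenlex_trans[of a b "{(False, True)}"]) (auto intro: transI)

lemma node_less_irrefl [simp]: "\<not> node_less a a"
  by (rule lenlex_irreflexive) auto

lemma node_less_length: "node_less a b \<Longrightarrow> length a \<le> length b"
  by (rule lenlex_length)

lemma node_less_shorter: "length a < length b \<Longrightarrow> node_less a b"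
  by (simp add: lenlex_conv)

lemma node_less_snoc:
  "node_less a b \<Longrightarrow> length a = length b \<Longrightarrow> node_less (a @ [c]) (b @ [d])"
  by (rule lenlex_append1) auto

text \<open>The list of all children of the first \<open>j\<close> nodes, preceded by the root; nothing is ever
  removed from it, so its \<open>j\<close>-th entry is the next node to be expanded.\<close>

primrec bfs :: "(nat \<Rightarrow> trit) \<Rightarrow> nat \<Rightarrow> bool list list" where
  "bfs x 0 = [[]]"
| "bfs x (Suc j) = bfs x j @ map (\<lambda>b. bfs x j ! j @ [b]) (trit_branches (x j))"

definition node :: "(nat \<Rightarrow> trit) \<Rightarrow> nat \<Rightarrow> bool list" where
  "node x j = bfs x j ! j"

text \<open>Every symbol contributes at least one child, so the queue never runs dry and the entry
  taken by \<open>node\<close> always exists.\<close>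

lemma length_bfs: "j < length (bfs x j)"
proof (induction j)
  case (Suc j)
  then show ?case
    by (cases "x j") auto
qed simp

lemma bfs_nth_mono: "i < length (bfs x j) \<Longrightarrow> j \<le> k \<Longrightarrow> i < length (bfs x k) \<and> bfs x k ! i = bfs x j ! i"
  by (induction k rule: nat_induct) (auto simp: le_Suc_eq nth_append)

lemma bfs_nth: "i < length (bfs x j) \<Longrightarrow> bfs x j ! i = node x i"
  unfolding node_def
  by (metis bfs_nth_mono length_bfs nle_le)

lemma bfs_Suc: "bfs x (Suc j) = bfs x j @ map (\<lambda>b. node x j @ [b]) (trit_branches (x j))"
  by (simp add: node_def)

lemma set_bfs: "set (bfs x j) = insert [] {node x i @ [b] |i b. i < j \<and> b \<in> branches (x i)}"
proof (induction j)
  case (Suc j)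
  show ?case
    unfolding bfs_Suc set_append Suc.IH by (auto simp: less_Suc_eq)
qed simp

text \<open>The length bound is carried along because it places a new child after all entries: a
  shorter entry precedes it by length, and an entry of equal length is the child of an earlier
  node.\<close>

lemma bfs_sorted:
  "sorted_wrt node_less (bfs x j) \<and>
   (\<forall>\<tau>\<in>set (bfs x j). length \<tau> \<le> Suc (length (node x j)))"
proof (induction j)
  case (Suc j)
  let ?k = "map (\<lambda>b. node x j @ [b]) (trit_branches (x j))"
  have old: "node_less \<tau> (node x j @ [b])" if \<tau>: "\<tau> \<in> set (bfs x j)" for \<tau> b
  proof (cases "length \<tau> = Suc (length (node x j))")
    case False
    with Suc \<tau> show ?thesis
      by (intro node_less_shorter) force
  next
    case True
    with \<tau> obtain i b' where i: "\<tau> = node x i @ [b']" "i < j"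
      by (auto simp: set_bfs)
    have "node_less (bfs x j ! i) (bfs x j ! j)"
      using Suc i length_bfs[of j x] by (auto intro: sorted_wrt_nth_less)
    then have "node_less (node x i) (node x j)"
      using i length_bfs[of j x] by (simp add: bfs_nth)
    then show ?thesis
      unfolding i using True i by (intro node_less_snoc) auto
  qed
  have sk: "sorted_wrt node_less ?k"
    by (cases "x j") (auto simp: lenlex_conv lex_conv)
  have S: "sorted_wrt node_less (bfs x (Suc j))"
    unfolding bfs_Suc sorted_wrt_append using Suc old sk by auto
  \<comment> \<open>Sortedness of the longer list makes the next node at least as long as the
    current one, so the length bound survives the step.\<close>
  have "node_less (bfs x (Suc j) ! j) (bfs x (Suc j) ! Suc j)"
    by (rule sorted_wrt_nth_less[OF S]) (use length_bfs[of "Suc j" x] in auto)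
  then have "node_less (node x j) (node x (Suc j))"
    using length_bfs[of "Suc j" x] bfs_nth[of j x "Suc j"] bfs_nth[of "Suc j" x "Suc j"] by simp
  then have le: "length (node x j) \<le> length (node x (Suc j))"
    by (rule node_less_length)
  have "length \<tau> \<le> Suc (length (node x (Suc j)))" if "\<tau> \<in> set (bfs x (Suc j))" for \<tau>
    using that Suc le unfolding bfs_Suc by auto
  with S show ?case by blast
qed simp

lemma node_strict_mono: "i < j \<Longrightarrow> node_less (node x i) (node x j)"
  using sorted_wrt_nth_less[OF conjunct1[OF bfs_sorted], of i j x j] length_bfs[of j x]
  by (simp add: bfs_nth)

lemma node_less_iff: "node_less (node x i) (node x j) \<longleftrightarrow> i < j"
  by (metis linorder_neqE_nat node_less_irrefl node_less_trans node_strict_mono)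

lemma inj_node: "inj (node x)"
  by (rule injI) (metis linorder_neqE_nat node_less_irrefl node_strict_mono)

lemma bfs_subset_range_node: "\<sigma> \<in> set (bfs x j) \<Longrightarrow> \<sigma> \<in> range (node x)"
  by (metis bfs_nth in_set_conv_nth rangeI)

lemma Nil_in_range_node: "[] \<in> range (node x)"
  by (rule bfs_subset_range_node[of _ x 0]) simp

lemma snoc_in_range_node:
  "\<sigma> @ [b] \<in> range (node x) \<longleftrightarrow> (\<exists>i. \<sigma> = node x i \<and> b \<in> branches (x i))"
proof
  assume "\<sigma> @ [b] \<in> range (node x)"
  then obtain j where "\<sigma> @ [b] = node x j" by auto
  then have "\<sigma> @ [b] \<in> set (bfs x j)"
    using length_bfs[of j x] by (simp add: node_def)
  then show "\<exists>i. \<sigma> = node x i \<and> b \<in> branches (x i)"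
    by (auto simp: set_bfs)
next
  assume "\<exists>i. \<sigma> = node x i \<and> b \<in> branches (x i)"
  then obtain i where "\<sigma> = node x i" "b \<in> branches (x i)" by blast
  then show "\<sigma> @ [b] \<in> range (node x)"
    by (intro bfs_subset_range_node[of _ x "Suc i"]) (auto simp: bfs_Suc simp del: bfs.simps)
qed

section \<open>Coded trees as ranges of the node enumeration\<close>

lemma length_tree_upto: "\<sigma> \<in> tree_upto x n \<Longrightarrow> length \<sigma> \<le> n"
  by (induction n) auto

text \<open>Exactly \<open>i\<close> of the nodes found so far precede \<open>node x i\<close>, by
  monotonicity of the enumeration; so the symbol that \<open>tree_upto\<close> looks up by counting
  is \<open>x i\<close>.\<close>

lemma tree_upto_eq_nodes: "tree_upto x n = {\<sigma> \<in> range (node x). length \<sigma> \<le> n}"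
proof (induction n)
  case 0
  then show ?case
    using Nil_in_range_node by auto
next
  case (Suc n)
  have rank: "card {\<tau> \<in> tree_upto x n. node_less \<tau> (node x i)} = i"
    if "length (node x i) = n" for i
  proof -
    have "{\<tau> \<in> tree_upto x n. node_less \<tau> (node x i)} = node x ` {..<i}"
      unfolding Suc.IH using that node_less_length by (fastforce simp: node_less_iff)
    then show ?thesis
      by (simp add: card_image inj_on_subset[OF inj_node])
  qed
  have "\<sigma> \<in> tree_upto x (Suc n) \<longleftrightarrow> \<sigma> \<in> range (node x) \<and> length \<sigma> \<le> Suc n" for \<sigma>
  proof (cases "length \<sigma> = Suc n")
    case True
    then obtain \<rho> b where \<sigma>: "\<sigma> = \<rho> @ [b]" "length \<rho> = n"
      by (metis length_Suc_conv_rev)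
    have "\<sigma> \<in> tree_upto x (Suc n) \<longleftrightarrow> \<rho> \<in> range (node x) \<and>
        b \<in> branches (x (card {\<tau> \<in> tree_upto x n. node_less \<tau> \<rho>}))"
      using True length_tree_upto[of \<sigma> x n] \<sigma> by (auto simp: Suc.IH)
    also have "\<dots> \<longleftrightarrow> (\<exists>i. \<rho> = node x i \<and> b \<in> branches (x i))"
      using rank \<sigma>(2) by auto
    finally show ?thesis
      using True unfolding \<sigma>(1) snoc_in_range_node by simp
  qed (auto simp: Suc.IH)
  then show ?case by blast
qed

lemma tree_eq_range_node: "tree x = range (node x)"
  unfolding tree_def tree_upto_eq_nodes by auto

lemma node_in_tree [simp]: "node x j \<in> tree x"
  by (simp add: tree_eq_range_node)

lemma Nil_in_tree [simp]: "[] \<in> tree x"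
  using Nil_in_range_node by (simp add: tree_eq_range_node)

lemma snoc_in_tree: "\<sigma> @ [b] \<in> tree x \<longleftrightarrow> (\<exists>i. \<sigma> = node x i \<and> b \<in> branches (x i))"
  by (simp add: tree_eq_range_node snoc_in_range_node)

lemma node_snoc_in_tree: "node x i @ [b] \<in> tree x \<longleftrightarrow> b \<in> branches (x i)"
  using inj_node by (auto simp: snoc_in_tree inj_eq)

lemma tree_append: "\<sigma> @ \<tau> \<in> tree x \<Longrightarrow> \<sigma> \<in> tree x"
  by (induction \<tau> rule: rev_induct) (auto simp flip: append_assoc simp: snoc_in_tree)

text \<open>The codes are compared symbol by symbol: equal queues expand the same node, and its
  children in the common tree determine the symbol.\<close>

lemma tree_inj: assumes "tree x = tree y" shows "x = y"
proof
  fix j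
  have step: "x i = y i" if "bfs x i = bfs y i" for i
  proof -
    have "node x i = node y i"
      using that by (simp add: node_def)
    then have "branches (x i) = branches (y i)"
      using assms node_snoc_in_tree[of x i] node_snoc_in_tree[of y i] by auto
    then show ?thesis by (rule branches_inj)
  qed
  have "bfs x i = bfs y i" for i
    by (induction i) (use step in auto)
  then show "x j = y j" by (rule step)
qed

lemma tree_child:
  assumes "\<sigma> \<in> tree x" shows "\<exists>b. \<sigma> @ [b] \<in> tree x"
proof -
  obtain i where "\<sigma> = node x i"
    using assms by (auto simp: tree_eq_range_node)
  moreover obtain b where "b \<in> branches (x i)"
    by (cases "x i") auto
  ultimately show ?thesis
    by (auto simp: node_snoc_in_tree)
qed

text \<open>The symbol of a node is forced by its children in \<open>T\<close>, but the index at
  which it must stand depends on the code under construction. The recursion \<open>B\<close> breaks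
  this circle by running the enumeration with symbols taken from the nodes themselves.\<close>

lemma tree_of_pruned:
  assumes nil: "[] \<in> T" and down: "\<And>\<sigma> b. \<sigma> @ [b] \<in> T \<Longrightarrow> \<sigma> \<in> T"
    and child: "\<And>\<sigma>. \<sigma> \<in> T \<Longrightarrow> \<exists>b. \<sigma> @ [b] \<in> T"
  shows "\<exists>x. tree x = T"
proof -
  define h where "h \<sigma> = (SOME a. branches a = {b. \<sigma> @ [b] \<in> T})" for \<sigma>
  have h: "branches (h \<sigma>) = {b. \<sigma> @ [b] \<in> T}" if "\<sigma> \<in> T" for \<sigma>
    unfolding h_def by (rule someI_ex, rule branches_surj) (use child[OF that] in auto)
  define B where "B = rec_nat [[]] (\<lambda>j l. l @ map (\<lambda>b. l ! j @ [b]) (trit_branches (h (l ! j))))"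
  define x where "x j = h (B j ! j)" for j
  have "bfs x j = B j" for j
    by (induction j) (simp_all add: B_def x_def)
  then have x: "x j = h (node x j)" for j
    by (simp add: x_def node_def)
  have "\<sigma> \<in> tree x \<longleftrightarrow> \<sigma> \<in> T" for \<sigma>
  proof (induction \<sigma> rule: rev_induct)
    case (snoc b \<sigma>)
    have "\<sigma> @ [b] \<in> tree x \<longleftrightarrow> \<sigma> \<in> tree x \<and> b \<in> branches (h \<sigma>)"
      unfolding snoc_in_range_node tree_eq_range_node using x by auto
    also have "\<dots> \<longleftrightarrow> \<sigma> @ [b] \<in> T"
      unfolding snoc.IH using h down by blast
    finally show ?case .
  qed (simp add: nil)
  then show ?thesis by blast
qed

lemma tree_extends_to_path:
  assumes "\<sigma> \<in> tree x"
  shows "\<exists>y\<in>paths (tree x). map y [0..<length \<sigma>] = \<sigma>"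
proof -
  define c where "c \<tau> = \<tau> @ [SOME b. \<tau> @ [b] \<in> tree x]" for \<tau>
  have c: "c \<tau> \<in> tree x" if "\<tau> \<in> tree x" for \<tau>
    unfolding c_def using tree_child[OF that] by (rule someI_ex)
  define s where "s k = (c ^^ k) \<sigma>" for k
  have s: "s k \<in> tree x" "length (s k) = length \<sigma> + k" for k
    unfolding s_def by (induction k) (use assms c in \<open>auto simp: c_def\<close>)
  have pre: "\<exists>\<rho>. s (k + d) = s k @ \<rho>" for k d
  proof (induction d)
    case (Suc d)
    have "s (k + Suc d) = c (s (k + d))" by (simp add: s_def)
    with Suc show ?case by (auto simp: c_def)
  qed simp
  define y where "y i = s (Suc i) ! i" for i
  have y: "s k ! i = y i" if "i < length (s k)" for k i
  proof (cases "k \<le> Suc i")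
    case True
    then obtain \<rho> where "s (Suc i) = s k @ \<rho>"
      using pre[of k "Suc i - k"] by auto
    then show ?thesis using that by (simp add: y_def nth_append)
  next
    case False
    then obtain \<rho> where "s k = s (Suc i) @ \<rho>"
      using pre[of "Suc i" "k - Suc i"] by auto
    then show ?thesis using s(2)[of "Suc i"] by (simp add: y_def nth_append)
  qed
  have take_s: "map y [0..<n] = take n (s k)" if "n \<le> length (s k)" for n k
    by (rule nth_equalityI) (use that y in auto)
  have "map y [0..<n] \<in> tree x" for n
    using take_s[of n n] s[of n] tree_append[of "take n (s n)" "drop n (s n)" x] by simp
  moreover have "map y [0..<length \<sigma>] = \<sigma>"
    using take_s[of "length \<sigma>" 0] by (simp add: s_def)
  ultimately show ?thesis
    unfolding paths_def by auto
qed

text \<open>Coded trees have no dead ends, so the set of paths determines the tree; together with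
  \<open>tree_inj\<close> this gives uniqueness of codes.\<close>

lemma tree_eq_prefixes: "\<sigma> \<in> tree x \<longleftrightarrow> (\<exists>y\<in>paths (tree x). map y [0..<length \<sigma>] = \<sigma>)"
proof
  assume "\<exists>y\<in>paths (tree x). map y [0..<length \<sigma>] = \<sigma>"
  then obtain y where "y \<in> paths (tree x)" "map y [0..<length \<sigma>] = \<sigma>" by blast
  then show "\<sigma> \<in> tree x"
    unfolding paths_def by (metis (lifting) mem_Collect_eq)
qed (rule tree_extends_to_path)

section \<open>Closed sets and their codes\<close>

lemma open_cylinder: "open {y :: nat \<Rightarrow> bool. map y [0..<n] = \<sigma>}"
proof (cases "length \<sigma> = n")
  case True
  have "{y. map y [0..<n] = \<sigma>} = (\<Inter>i<n. {y. y i \<in> {\<sigma> ! i}})"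
    using True by (auto simp: list_eq_iff_nth_eq)
  moreover have "open {y :: nat \<Rightarrow> bool. y i \<in> {b}}" for i b
  proof -
    have "open ((\<lambda>y :: nat \<Rightarrow> bool. y i) -` {b})"
      by (intro open_vimage continuous_on_product_coordinates) (rule discrete_topology_class.open_discrete)
    then show ?thesis by (simp add: vimage_def)
  qed
  ultimately show ?thesis by auto
next
  case False
  then have "{y :: nat \<Rightarrow> bool. map y [0..<n] = \<sigma>} = {}" by auto
  then show ?thesis by simp
qed

lemma paths_closed: "closed (paths T)"
proof -
  have "- paths T = (\<Union>n. \<Union>\<sigma>\<in>-T. {y. map y [0..<n] = \<sigma>})"
    unfolding paths_def by auto
  moreover have "open \<dots>"
    by (intro open_UN ballI open_cylinder)
  ultimately show ?thesis
    by (simp add: closed_def)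
qed

lemma closed_eq_paths:
  assumes "closed C"
  shows "paths {map y [0..<n] |y n. y \<in> C} = C"
proof
  show "C \<subseteq> paths {map y [0..<n] |y n. y \<in> C}"
    unfolding paths_def by auto
  show "paths {map y [0..<n] |y n. y \<in> C} \<subseteq> C"
  proof
    fix y assume "y \<in> paths {map y [0..<n] |y n. y \<in> C}"
    then have y: "\<exists>u\<in>C. map u [0..<n] = map y [0..<n]" for n
      unfolding paths_def
      by (smt (verit) diff_zero length_map length_upt mem_Collect_eq)
    show "y \<in> C"
    proof (rule ccontr)
      assume "y \<notin> C"
      moreover have "open (- C)" using assms by auto
      ultimately obtain X where X: "y \<in> Pi\<^sub>E UNIV X" "finite {i. X i \<noteq> UNIV}" "Pi\<^sub>E UNIV X \<subseteq> - C"
        using product_topology_open_contains_basis[of "\<lambda>_. euclidean :: bool topology" UNIV "- C" y]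
        unfolding open_fun_def by auto
      \<comment> \<open>A basic open set restricts finitely many coordinates, so it contains every
        point that agrees with \<open>y\<close> below some \<open>n\<close>.\<close>
      obtain n where n: "\<And>i. X i \<noteq> UNIV \<Longrightarrow> i < n"
        using X(2) finite_nat_set_iff_bounded by auto
      obtain u where u: "u \<in> C" "map u [0..<n] = map y [0..<n]"
        using y by blast
      have "u i \<in> X i" for i
        using n[of i] X(1) u(2) by (cases "X i = UNIV") (auto simp: PiE_iff)
      then have "u \<in> Pi\<^sub>E UNIV X" by (simp add: PiE_iff)
      then show False using X(3) u(1) by blast
    qed
  qed
qed

lemma paths_tree_in_closed_subsets: "paths (tree x) \<in> closed_subsets"
  using tree_extends_to_path[of "[]" x] paths_closed unfolding closed_subsets_def by auto

lemma code_paths_tree [simp]: "code (paths (tree x)) = x"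
  unfolding code_def
proof (rule the_equality)
  fix x' assume "paths (tree x') = paths (tree x)"
  then have "tree x' = tree x"
    using tree_eq_prefixes[of _ x] tree_eq_prefixes[of _ x'] by auto
  then show "x' = x" by (rule tree_inj)
qed simp

text \<open>The prefixes of points of \<open>C\<close> form a tree without dead ends, whose root is
  present because \<open>C\<close> is nonempty; such a tree has a code, and closedness recovers
  \<open>C\<close> from it.\<close>

lemma paths_tree_code:
  assumes "C \<in> closed_subsets" shows "paths (tree (code C)) = C"
proof -
  define T where "T = {map y [0..<n] |y n. y \<in> C}"
  have T: "\<sigma> \<in> T \<longleftrightarrow> (\<exists>y n. \<sigma> = map y [0..<n] \<and> y \<in> C)" for \<sigma>
    unfolding T_def mem_Collect_eq ..
  obtain y where "y \<in> C" using assms by (auto simp: closed_subsets_def)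
  moreover have "[] = map y [0..<0]" by simp
  ultimately have "[] \<in> T"
    unfolding T by blast
  moreover have "\<sigma> \<in> T" if \<sigma>: "\<sigma> @ [b] \<in> T" for \<sigma> b
  proof -
    obtain y n where y: "\<sigma> @ [b] = map y [0..<n]" "y \<in> C"
      using \<sigma> unfolding T by blast
    then have "\<sigma> = map y [0..<n - 1]"
      by (cases n) auto
    with y show ?thesis unfolding T by blast
  qed
  moreover have "\<exists>b. \<sigma> @ [b] \<in> T" if \<sigma>: "\<sigma> \<in> T" for \<sigma>
  proof -
    obtain y n where y: "\<sigma> = map y [0..<n]" "y \<in> C"
      using \<sigma> unfolding T by blast
    then have "\<sigma> @ [y n] = map y [0..<Suc n]" by simp
    with y show ?thesis unfolding T by blast
  qed
  ultimately obtain x where "tree x = T"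
    using tree_of_pruned[of T] by blast
  then have "paths (tree x) = C"
    using closed_eq_paths assms by (simp add: closed_subsets_def T_def)
  then show ?thesis by auto
qed

section \<open>Computable functions\<close>

abbreviation pfst :: "nat \<Rightarrow> nat" where "pfst a \<equiv> fst (prod_decode a)"
abbreviation psnd :: "nat \<Rightarrow> nat" where "psnd a \<equiv> snd (prod_decode a)"

lemma computable_id: "computable_in g (\<lambda>a. a)"
  using pair[OF left right] by simp

lemma computable_const: "computable_in g (\<lambda>_. c)"
proof (induction c)
  case (Suc c)
  then show ?case using comp[OF succ] by blast
qed (rule zero)

lemma computable_pfst: "computable_in g f \<Longrightarrow> computable_in g (\<lambda>a. pfst (f a))"
  by (rule comp[OF left])

lemma computable_psnd: "computable_in g f \<Longrightarrow> computable_in g (\<lambda>a. psnd (f a))"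
  by (rule comp[OF right])

lemma computable_Suc: "computable_in g f \<Longrightarrow> computable_in g (\<lambda>a. Suc (f a))"
  by (rule comp[OF succ])

lemma computable_rec:
  assumes "computable_in g f" "computable_in g n"
    and "computable_in g (\<lambda>e. h (pfst e) (pfst (psnd e)) (psnd (psnd e)))"
  shows "computable_in g (\<lambda>a. rec_nat (f a) (h a) (n a))"
  using comp[OF prec[OF assms(1,3)] pair[OF computable_id assms(2)]] by simp

lemma computable_add:
  assumes "computable_in g f" "computable_in g h"
  shows "computable_in g (\<lambda>a. f a + h a)"
proof -
  have "rec_nat x (\<lambda>_ r. Suc r) y = x + y" for x y :: nat
    by (induction y) auto
  then show ?thesis
    using computable_rec[OF assms, of "\<lambda>_ _ r. Suc r"]
    by (simp add: computable_Suc computable_psnd computable_id)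
qed

lemma computable_pred:
  assumes "computable_in g f"
  shows "computable_in g (\<lambda>a. f a - 1)"
proof -
  have "rec_nat 0 (\<lambda>k _. k) y = y - 1" for y :: nat
    by (cases y) auto
  then show ?thesis
    using computable_rec[OF zero assms, of "\<lambda>_ k _. k"]
    by (simp add: computable_pfst computable_psnd computable_id)
qed

lemma computable_diff:
  assumes "computable_in g f" "computable_in g h"
  shows "computable_in g (\<lambda>a. f a - h a)"
proof -
  have "rec_nat x (\<lambda>_ r. r - 1) y = x - y" for x y :: nat
    by (induction y) auto
  then show ?thesis
    using computable_rec[OF assms, of "\<lambda>_ _ r. r - 1"]
      computable_pred[OF computable_psnd[OF computable_psnd[OF computable_id]]] by simp
qed

lemma computable_mult:
  assumes "computable_in g f" "computable_in g h"
  shows "computable_in g (\<lambda>a. f a * h a)"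
proof -
  have "rec_nat 0 (\<lambda>_ r. r + x) y = x * y" for x y :: nat
    by (induction y) auto
  then show ?thesis
    using computable_rec[OF zero assms(2), of "\<lambda>a _ r. r + f a"]
    by (simp add: computable_add computable_pfst computable_psnd computable_id comp[OF assms(1)])
qed

lemma computable_power:
  assumes "computable_in g f" "computable_in g h"
  shows "computable_in g (\<lambda>a. f a ^ h a)"
proof -
  have "rec_nat (Suc 0) (\<lambda>_ r. r * x) y = x ^ y" for x y :: nat
    by (induction y) auto
  then show ?thesis
    using computable_rec[OF computable_const[of g "Suc 0"] assms(2), of "\<lambda>a _ r. r * f a"]
    by (simp add: computable_mult computable_pfst computable_psnd computable_id comp[OF assms(1)])
qed

lemma computable_sum:
  assumes "computable_in g n" "computable_in g (\<lambda>e. f (pfst e) (psnd e))"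
  shows "computable_in g (\<lambda>a. \<Sum>k<n a. f a k)"
proof -
  have "rec_nat 0 (\<lambda>k r. r + f x k) y = (\<Sum>k<y. f x k)" for x y
    by (induction y) auto
  then show ?thesis
    using computable_rec[OF zero assms(1), of "\<lambda>a k r. r + f a k"]
      comp[OF assms(2) pair[OF computable_pfst[OF computable_id]
          computable_pfst[OF computable_psnd[OF computable_id]]]]
    by (simp add: computable_add computable_psnd computable_id)
qed

abbreviation decidable_in :: "(nat \<Rightarrow> nat) \<Rightarrow> (nat \<Rightarrow> bool) \<Rightarrow> bool" where
  "decidable_in g P \<equiv> computable_in g (\<lambda>a. of_bool (P a))"

lemma decidable_less:
  assumes "computable_in g f" "computable_in g h"
  shows "decidable_in g (\<lambda>a. f a < h a)"
proof -
  have "of_bool (x < y) = 1 - (1 - (y - x))" for x y :: nat by auto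
  then show ?thesis using assms by (simp add: computable_diff computable_const del: One_nat_def)
qed

lemma decidable_not:
  assumes "decidable_in g P" shows "decidable_in g (\<lambda>a. \<not> P a)"
proof -
  have "of_bool (\<not> x) = 1 - (of_bool x :: nat)" for x by auto
  then show ?thesis using assms by (simp add: computable_diff computable_const)
qed

lemma decidable_conj:
  assumes "decidable_in g P" "decidable_in g Q" shows "decidable_in g (\<lambda>a. P a \<and> Q a)"
  using assms by (simp add: of_bool_conj computable_mult)

lemma decidable_eq:
  assumes "computable_in g f" "computable_in g h"
  shows "decidable_in g (\<lambda>a. f a = h a)"
proof -
  have "x = y \<longleftrightarrow> \<not> x < y \<and> \<not> y < x" for x y :: nat by auto
  then show ?thesis
    using assms by (simp only: decidable_less decidable_conj decidable_not)
qed

lemma decidable_le: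
  assumes "computable_in g f" "computable_in g h"
  shows "decidable_in g (\<lambda>a. f a \<le> h a)"
  using decidable_not[OF decidable_less[OF assms(2,1)]] by (simp add: not_less)

lemma decidable_bex:
  assumes "computable_in g n" "decidable_in g (\<lambda>e. P (pfst e) (psnd e))"
  shows "decidable_in g (\<lambda>a. \<exists>k<n a. P a k)"
proof -
  have "(\<exists>k<y. P x k) \<longleftrightarrow> 0 < (\<Sum>k<y. of_bool (P x k) :: nat)" for x y
    by (subst neq0_conv[symmetric], subst sum_eq_0_iff) (auto simp del: of_bool_eq_0_iff simp: of_bool_def)
  then show ?thesis
    using decidable_less[OF zero computable_sum[OF assms]] by simp
qed

lemma computable_if:
  assumes "decidable_in g P" "computable_in g f" "computable_in g h"
  shows "computable_in g (\<lambda>a. if P a then f a else h a)"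
proof -
  have "(if b then x else y) = of_bool b * x + (1 - of_bool b) * y" for b and x y :: nat by auto
  then show ?thesis
    using assms by (simp only: computable_add computable_mult computable_diff computable_const)
qed

lemma computable_div:
  assumes "computable_in g f" "computable_in g h"
  shows "computable_in g (\<lambda>a. f a div h a)"
proof -
  \<comment> \<open>The quotient counts the positive multiples of \<open>y\<close> that are at most
    \<open>x\<close>; division by zero needs the default value 0.\<close>
  have eq: "x div y = (if 0 < y then \<Sum>k<x. of_bool (Suc k * y \<le> x) else 0)" for x y :: nat
  proof (cases "0 < y")
    case True
    have "Suc k \<le> x" if "Suc k * y \<le> x" for k
      using order_trans[OF _ that, of "Suc k * 1"] True by (simp del: mult_Suc)
    with True have "{..<x} \<inter> {k. Suc k * y \<le> x} = {..<x div y}"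
      using div_le_dividend[of x y]
      by (auto simp: less_eq_div_iff_mult_less_eq simp del: mult_Suc simp flip: Suc_le_eq)
    with True show ?thesis by (simp add: of_bool_def sum.If_cases)
  qed simp
  have *: "computable_in g (\<lambda>e. f (pfst e))" "computable_in g (\<lambda>e. h (pfst e))"
    using assms by (auto intro: comp[of g f] comp[of g h] left)
  show ?thesis unfolding eq
    by (intro computable_if decidable_less computable_const computable_sum assms decidable_le
        computable_mult computable_Suc computable_psnd computable_id *)
qed

lemma computable_mod:
  assumes "computable_in g f" "computable_in g h"
  shows "computable_in g (\<lambda>a. f a mod h a)"
  using assms by (simp add: modulo_nat_def computable_diff computable_mult computable_div)

lemmas computable_intros = computable_id computable_const computable_pfst computable_psnd
  computable_Suc pair computable_add computable_diff computable_mult computable_power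
  computable_div computable_mod computable_sum computable_if decidable_less decidable_le
  decidable_eq decidable_not decidable_conj decidable_bex

lemma computable_in_mono: "computable_in (\<lambda>_. 0) f \<Longrightarrow> computable_in g f"
  by (induction rule: computable_in.induct) (auto intro: computable_in.intros)

lemma ce_in_image:
  assumes "computable_in g f" "decidable_in g P"
  shows "ce_in g {f v |v. P v}"
proof (cases "\<exists>v. P v")
  case True
  then obtain v0 where v0: "P v0" ..
  \<comment> \<open>An enumeration must be total, so arguments outside \<open>P\<close> repeat a
    value already in the set.\<close>
  have "{f v |v. P v} = range (\<lambda>v. if P v then f v else f v0)"
    using v0 by auto
  moreover have "computable_in g (\<lambda>v. if P v then f v else f v0)"
    by (intro computable_intros assms)
  ultimately show ?thesis unfolding ce_in_def by blast
qed (auto simp: ce_in_def)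

text \<open>Syntax trees for the closure clauses, introduced to count the computable functions.
  Regularity of a minimization cannot be read off its tree; \<open>run_program\<close> therefore
  gives every tree some total meaning, which is enough for a countable covering.\<close>

datatype program = Zero | Succ | Left | Right | Query | Pair program program
  | Comp program program | Prec program program | Minim program

instance program :: countable
  by countable_datatype

primrec run_program :: "(nat \<Rightarrow> nat) \<Rightarrow> program \<Rightarrow> nat \<Rightarrow> nat" where
  "run_program g Zero = (\<lambda>_. 0)"
| "run_program g Succ = Suc"
| "run_program g Left = pfst"
| "run_program g Right = psnd"
| "run_program g Query = g"
| "run_program g (Pair P Q) = (\<lambda>a. prod_encode (run_program g P a, run_program g Q a))"
| "run_program g (Comp P Q) = (\<lambda>a. run_program g P (run_program g Q a))"
| "run_program g (Prec P Q) = (\<lambda>a. rec_nat (run_program g P (pfst a))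
    (\<lambda>k r. run_program g Q (prod_encode (pfst a, prod_encode (k, r)))) (psnd a))"
| "run_program g (Minim P) = (\<lambda>a. LEAST k. run_program g P (prod_encode (a, k)) = 0)"

lemma countable_computable: "countable {f. computable_in g f}"
proof -
  have "f \<in> range (run_program g)" if "computable_in g f" for f
    using that
  proof (induction rule: computable_in.induct)
    case zero then show ?case by (intro range_eqI[of _ _ Zero]) simp
  next
    case succ then show ?case by (intro range_eqI[of _ _ Succ]) simp
  next
    case left then show ?case by (intro range_eqI[of _ _ Left]) simp
  next
    case right then show ?case by (intro range_eqI[of _ _ Right]) simp
  next
    case query then show ?case by (intro range_eqI[of _ _ Query]) simp
  next
    case (pair f h)
    then obtain P Q where "f = run_program g P" "h = run_program g Q" by auto
    then show ?case by (intro range_eqI[of _ _ "Pair P Q"]) simp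
  next
    case (comp f h)
    then obtain P Q where "f = run_program g P" "h = run_program g Q" by auto
    then show ?case by (intro range_eqI[of _ _ "Comp P Q"]) simp
  next
    case (prec f h)
    then obtain P Q where "f = run_program g P" "h = run_program g Q" by auto
    then show ?case by (intro range_eqI[of _ _ "Prec P Q"]) simp
  next
    case (minim f)
    then obtain P where "f = run_program g P" by auto
    then show ?case by (intro range_eqI[of _ _ "Minim P"]) simp
  qed
  then show ?thesis
    by (intro countable_subset[OF _ countable_image[of UNIV "run_program g"]]) auto
qed

lemma countable_ce: "countable {W. ce_in g W}"
proof -
  have "{W. ce_in g W} \<subseteq> insert {} (range ` {f. computable_in g f})"
    by (auto simp: ce_in_def)
  then show ?thesis
    by (rule countable_subset) (intro countable_insert countable_image countable_computable)
qed

section \<open>Random codes of supersets\<close>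

definition widen :: "trit \<Rightarrow> bool \<Rightarrow> trit" where
  "widen a s = (if s then a else T2)"

text \<open>Breadth-first construction of the tree of \<open>y\<close>: the queue holds, for each node found but not
  yet expanded, whether it lies in the tree of \<open>x\<close>. Expanding a node of the tree of \<open>x\<close> consumes one
  symbol \<open>a\<close> of \<open>x\<close>, so \<open>x\<close> is read sequentially; \<open>c\<close> is the symbol of \<open>y\<close>.\<close>

definition next_tags :: "bool list \<Rightarrow> trit \<Rightarrow> trit \<Rightarrow> bool list" where
  "next_tags w a c = tl w @ map (\<lambda>b. hd w \<and> b \<in> branches a) (trit_branches c)"

text \<open>Follows the construction along a given \<open>y\<close> instead of a random one; the
  number counts the symbols of \<open>x\<close> consumed. With \<open>y\<close> as a parameter, the
  conditional law of \<open>y\<close> becomes a product over positions, see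
  \<open>weight_eq_prod\<close>.\<close>

primrec run :: "bool list \<Rightarrow> (nat \<Rightarrow> trit) \<Rightarrow> (nat \<Rightarrow> trit) \<Rightarrow> nat \<Rightarrow> bool list \<times> nat" where
  "run w x y 0 = (w, 0)"
| "run w x y (Suc j) = (case run w x y j of (v, r) \<Rightarrow>
     (next_tags v (x r) (y j), if hd v then Suc r else r))"

text \<open>\<open>run\<close> adds a step at the end, whereas \<open>emit\<close> and
  \<open>weight\<close> peel off the first one; this identity reconciles the two recursions.\<close>

lemma run_shift:
  "run w x y (Suc j) = (if hd w then apsnd Suc (run (next_tags w (x 0) (y 0)) (\<lambda>i. x (Suc i)) (\<lambda>i. y (Suc i)) j)
     else run (next_tags w (x 0) (y 0)) x (\<lambda>i. y (Suc i)) j)"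
proof (induction j)
  case (Suc j)
  show ?case
    unfolding run.simps(2)[of w x y "Suc j"] Suc.IH
    by (simp add: split_beta)
qed simp

lemma bfs_drop: "drop j (bfs x j) = node x j # drop (Suc j) (bfs x j)"
  using length_bfs[of j x] by (simp add: Cons_nth_drop_Suc node_def)

lemma bfs_drop_Suc: "drop (Suc j) (bfs x (Suc j)) =
    drop (Suc j) (bfs x j) @ map (\<lambda>b. node x j @ [b]) (trit_branches (x j))"
  using length_bfs[of j x] by (simp add: node_def)

text \<open>Reason why \<open>x\<close> may be read sequentially: the queue of \<open>y\<close>,
  restricted to nodes of the tree of \<open>x\<close>, is the queue of \<open>x\<close>. The
  hypothesis that symbols are only widened keeps all children of a common node, and keeping their
  order is automatic.\<close>

lemma run_bfs:
  assumes "\<And>j v r. run [True] x y j = (v, r) \<Longrightarrow> hd v \<Longrightarrow> branches (x r) \<subseteq> branches (y j)"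
    and "run [True] x y j = (w, r)"
  shows "w = map (\<lambda>\<sigma>. \<sigma> \<in> tree x) (drop j (bfs y j)) \<and>
    filter (\<lambda>\<sigma>. \<sigma> \<in> tree x) (drop j (bfs y j)) = drop r (bfs x r)"
  using assms(2)
proof (induction j arbitrary: w r)
  case (Suc j)
  obtain v s where vs: "run [True] x y j = (v, s)" by fastforce
  note IH = Suc.IH[OF vs, unfolded bfs_drop[of j y]]
  let ?Q = "drop (Suc j) (bfs y j)"
  have w: "w = next_tags v (x s) (y j)" and r: "r = (if hd v then Suc s else s)"
    using Suc.prems vs by auto
  have v: "hd v \<longleftrightarrow> node y j \<in> tree x" "tl v = map (\<lambda>\<sigma>. \<sigma> \<in> tree x) ?Q"
    using IH by auto
  show ?case
  proof (cases "node y j \<in> tree x")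
    case True
    then have ns: "node y j = node x s" and Q: "filter (\<lambda>\<sigma>. \<sigma> \<in> tree x) ?Q = drop (Suc s) (bfs x s)"
      using IH unfolding bfs_drop[of s x] by auto
    have "branches (x s) \<subseteq> branches (y j)"
      using assms(1)[OF vs] v True by blast
    then have "filter (\<lambda>b. b \<in> branches (x s)) (trit_branches (y j)) = trit_branches (x s)"
      by (cases "x s"; cases "y j") auto
    then show ?thesis
      unfolding w r bfs_drop_Suc next_tags_def v using True
      by (simp add: bfs_drop_Suc ns Q node_snoc_in_tree filter_map comp_def del: bfs.simps)
  next
    case False
    then have k: "node y j @ [b] \<notin> tree x" for b
      using tree_append by blast
    then show ?thesis
      unfolding w r bfs_drop_Suc next_tags_def v using False IH
      by (simp add: filter_map comp_def)
  qed
qed simp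

lemma run_at_common_node:
  assumes "\<forall>j v r. run [True] x y j = (v, r) \<longrightarrow> hd v \<longrightarrow> branches (x r) \<subseteq> branches (y j)"
    and "node y j \<in> tree x" and "run [True] x y j = (w, r)"
  shows "hd w" "node y j = node x r"
  using run_bfs[OF assms(1)[rule_format] assms(3)] assms(2) unfolding bfs_drop[of r x] bfs_drop[of j y] by auto

text \<open>Widening loses no node of the tree of \<open>x\<close>. Conversely, at the
  \<open>r\<close>-th node of \<open>x\<close> some code repeats the symbol, so a child present in
  all trees is a child in the tree of \<open>x\<close>. The choices \<open>s i r\<close> are indexed
  by \<open>r\<close> and not by the position in \<open>y i\<close>, since the latter differs from
  code to code.\<close>

lemma tree_eq_Inter_trees:
  assumes y: "\<And>i j v r. i \<in> I \<Longrightarrow> run [True] x (y i) j = (v, r) \<Longrightarrow> hd v \<Longrightarrow>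
      y i j = widen (x r) (s i r)"
    and I: "\<And>r. \<exists>i\<in>I. s i r"
  shows "(\<Inter>i\<in>I. tree (y i)) = tree x"
proof -
  have sub: "branches (x r) \<subseteq> branches (y i j)"
    if "i \<in> I" "run [True] x (y i) j = (v, r)" "hd v" for i j v r
    unfolding y[OF that] widen_def by (cases "x r") auto
  then have sub': "\<forall>j v r. run [True] x (y i) j = (v, r) \<longrightarrow> hd v \<longrightarrow>
      branches (x r) \<subseteq> branches (y i j)" if "i \<in> I" for i
    using that by blast
  have up: "\<sigma> \<in> tree x \<Longrightarrow> \<sigma> \<in> tree (y i)" if i: "i \<in> I" for \<sigma> i
  proof (induction \<sigma> rule: rev_induct)
    case (snoc b \<sigma>)
    then have \<sigma>: "\<sigma> \<in> tree x" by (metis tree_append)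
    with snoc obtain j where j: "\<sigma> = node (y i) j"
      by (auto simp: tree_eq_range_node)
    obtain w r where wr: "run [True] x (y i) j = (w, r)" by fastforce
    have w: "hd w" and r: "\<sigma> = node x r"
      using run_at_common_node[OF sub'[OF i] _ wr] \<sigma> j by auto
    have "b \<in> branches (y i j)"
      using snoc.prems sub[OF i wr w] unfolding r node_snoc_in_tree by blast
    then show ?case
      unfolding j node_snoc_in_tree .
  qed simp
  have "\<sigma> \<in> tree x" if "\<forall>i\<in>I. \<sigma> \<in> tree (y i)" for \<sigma>
    using that
  proof (induction \<sigma> rule: rev_induct)
    case (snoc b \<sigma>)
    then have "\<sigma> \<in> tree x" by (metis tree_append)
    then obtain k where k: "\<sigma> = node x k"
      by (auto simp: tree_eq_range_node)
    obtain i where i: "i \<in> I" "s i k" using I by blast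
    have "\<sigma> \<in> tree (y i)"
      using snoc.prems i by (metis tree_append)
    then obtain j where j: "\<sigma> = node (y i) j"
      by (auto simp: tree_eq_range_node)
    obtain w r where wr: "run [True] x (y i) j = (w, r)" by fastforce
    have "node (y i) j \<in> tree x"
      using j k by (metis node_in_tree)
    from run_at_common_node[OF sub'[OF i(1)] this wr]
    have w: "hd w" and "node x k = node x r"
      using j k by auto
    then have "r = k"
      using inj_node[of x] by (auto simp: inj_eq)
    then have "y i j = x k"
      using y[OF i(1) wr w] i(2) by (simp add: widen_def)
    then show ?case
      using snoc.prems i j k by (metis node_snoc_in_tree)
  qed simp
  with up show ?thesis by blast
qed

text \<open>A node of the tree of \<open>x\<close> advances \<open>x\<close> and \<open>s\<close>,
  any other node advances \<open>t\<close>. Each draw is thus used for one node only, which makes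
  the conditional law a product.\<close>

primrec emit :: "nat \<Rightarrow> bool list \<Rightarrow> (nat \<Rightarrow> trit) \<Rightarrow> (nat \<Rightarrow> bool) \<Rightarrow> (nat \<Rightarrow> trit) \<Rightarrow> trit" where
  "emit 0 w x s t = (if hd w then widen (x 0) (s 0) else t 0)"
| "emit (Suc j) w x s t = (if hd w
     then emit j (next_tags w (x 0) (widen (x 0) (s 0))) (\<lambda>i. x (Suc i)) (\<lambda>i. s (Suc i)) t
     else emit j (next_tags w (x 0) (t 0)) x s (\<lambda>i. t (Suc i)))"

lemma emit_run:
  "run w x (\<lambda>j. emit j w x s t) j = (v, r) \<Longrightarrow> hd v \<Longrightarrow>
    emit j w x s t = widen (x r) (s r)"
proof (induction j arbitrary: w x s t v r)
  case (Suc j)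
  show ?case
  proof (cases "hd w")
    case True
    with Suc.prems obtain r' where r': "r = Suc r'"
      "run (next_tags w (x 0) (widen (x 0) (s 0))) (\<lambda>i. x (Suc i))
        (\<lambda>j. emit j (next_tags w (x 0) (widen (x 0) (s 0))) (\<lambda>i. x (Suc i)) (\<lambda>i. s (Suc i)) t) j = (v, r')"
      unfolding run_shift by (cases "run (next_tags w (x 0) (widen (x 0) (s 0))) (\<lambda>i. x (Suc i))
        (\<lambda>j. emit j (next_tags w (x 0) (widen (x 0) (s 0))) (\<lambda>i. x (Suc i)) (\<lambda>i. s (Suc i)) t) j") auto
    show ?thesis
      using Suc.IH[OF r'(2) Suc.prems(2)] True r'(1) by simp
  next
    case False
    with Suc.prems have "run (next_tags w (x 0) (t 0)) x
        (\<lambda>j. emit j (next_tags w (x 0) (t 0)) x s (\<lambda>i. t (Suc i))) j = (v, r)"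
      unfolding run_shift by simp
    from Suc.IH[OF this Suc.prems(2)] False show ?thesis by simp
  qed
qed simp

text \<open>The conditional probability, given \<open>x\<close>, of the first \<open>L\<close> symbols of \<open>y\<close>. The target type is
  general because the same product is later evaluated with natural number factors.\<close>

primrec weight :: "(trit \<Rightarrow> trit \<Rightarrow> 'a) \<Rightarrow> (trit \<Rightarrow> 'a) \<Rightarrow> nat \<Rightarrow> bool list \<Rightarrow>
    (nat \<Rightarrow> trit) \<Rightarrow> (nat \<Rightarrow> trit) \<Rightarrow> 'a::comm_monoid_mult" where
  "weight K q 0 w x y = 1"
| "weight K q (Suc L) w x y = (if hd w
     then K (x 0) (y 0) * weight K q L (next_tags w (x 0) (y 0)) (\<lambda>i. x (Suc i)) (\<lambda>i. y (Suc i))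
     else q (y 0) * weight K q L (next_tags w (x 0) (y 0)) x (\<lambda>i. y (Suc i)))"

lemma weight_eq_prod: "weight K q L w x y =
    (\<Prod>j<L. case run w x y j of (v, r) \<Rightarrow> if hd v then K (x r) (y j) else q (y j))"
proof (induction L arbitrary: w x y)
  case (Suc L)
  show ?case
    unfolding prod.lessThan_Suc_shift run_shift weight.simps(2) Suc.IH
    by (cases "hd w") (simp_all add: apsnd_def map_prod_def split_beta)
qed simp

text \<open>Each step consumes at most one symbol of \<open>x\<close>, so \<open>L\<close> steps see
  only the first \<open>L\<close> of them. This is what makes the induced test sets open.\<close>

lemma weight_cong:
  assumes "\<And>i. i < L \<Longrightarrow> x i = x' i" "\<And>i. i < L \<Longrightarrow> y i = y' i"
  shows "weight K q L w x y = weight K q L w x' y'"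
  using assms
proof (induction L arbitrary: w x x' y y')
  case (Suc L)
  have 0: "x 0 = x' 0" "y 0 = y' 0"
    using Suc.prems by blast+
  have IH: "weight K q L v (\<lambda>i. x (Suc i)) (\<lambda>i. y (Suc i)) =
      weight K q L v (\<lambda>i. x' (Suc i)) (\<lambda>i. y' (Suc i))"
    "weight K q L v x (\<lambda>i. y (Suc i)) = weight K q L v x' (\<lambda>i. y' (Suc i))" for v
    by (rule Suc.IH; simp add: Suc.prems(1) Suc.prems(2))+
  show ?case
    unfolding weight.simps IH 0 ..
qed simp

section \<open>The law of the random code\<close>

abbreviation iid :: "'a pmf \<Rightarrow> (nat \<Rightarrow> 'a) measure" where
  "iid D \<equiv> PiM UNIV (\<lambda>_. measure_pmf D)"

lemma sequence_space_pmf: "sequence_space (measure_pmf D)"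
  by unfold_locales

lemma prob_space_iid: "prob_space (iid D)"
  by (rule prob_space_PiM) (rule prob_space_measure_pmf)

lemma measurable_iid_component [measurable]: "(\<lambda>x. x i) \<in> measurable (iid D) (count_space UNIV)"
  using measurable_component_singleton[of i UNIV "\<lambda>_. measure_pmf D"]
  by (simp cong: measurable_cong_sets)

lemma measurable_iid_shift [measurable]: "(\<lambda>x i. x (Suc i)) \<in> measurable (iid D) (iid D)"
  by (rule measurable_PiM_single') (auto simp: space_PiM intro!: measurable_component_singleton)

lemma measurable_iid_Cons [measurable]: "case_nat d \<in> measurable (iid D) (iid D)"
  by (rule measurable_PiM_single')
     (auto simp: space_PiM split: nat.split intro!: measurable_component_singleton)

text \<open>Fubini after identifying the sequence space with a first coordinate followed by an
  independent copy of itself; it drives the inductions that peel off one symbol.\<close>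

lemma nn_integral_iid:
  assumes [measurable]: "f \<in> borel_measurable (iid D)"
  shows "(\<integral>\<^sup>+x. f x \<partial>iid D) = (\<integral>\<^sup>+d. (\<integral>\<^sup>+x. f (case_nat d x) \<partial>iid D) \<partial>measure_pmf D)"
proof -
  interpret S: prob_space "iid D" by (rule prob_space_iid)
  interpret sequence_space "measure_pmf D" by (rule sequence_space_pmf)
  have [measurable]: "(\<lambda>(d, x). case_nat d x) \<in> measurable (measure_pmf D \<Otimes>\<^sub>M iid D) (iid D)"
    by (rule measurable_PiM_single') (auto simp: space_PiM split_beta split: nat.split
        intro!: measurable_component_singleton measurable_compose[OF measurable_snd])
  have "(\<integral>\<^sup>+x. f x \<partial>iid D) = (\<integral>\<^sup>+x. f x \<partial>distr (measure_pmf D \<Otimes>\<^sub>M iid D) (iid D) (\<lambda>(d, x). case_nat d x))"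
    by (simp add: PiM_iter)
  also have "\<dots> = (\<integral>\<^sup>+z. f (case_nat (fst z) (snd z)) \<partial>(measure_pmf D \<Otimes>\<^sub>M iid D))"
    by (subst nn_integral_distr) (auto simp: split_beta)
  also have "\<dots> = (\<integral>\<^sup>+d. (\<integral>\<^sup>+x. f (case_nat d x) \<partial>iid D) \<partial>measure_pmf D)"
    by (subst S.nn_integral_fst[symmetric]) (auto simp: split_beta)
  finally show ?thesis .
qed

lemma nn_integral_pmf_of_bool:
  "(\<integral>\<^sup>+d. of_bool (P d) * c \<partial>measure_pmf D) = ennreal (measure_pmf.prob D {d. P d}) * c"
proof -
  have "(\<integral>\<^sup>+d. of_bool (P d) * c \<partial>measure_pmf D) = (\<integral>\<^sup>+d. c * indicator {d. P d} d \<partial>measure_pmf D)"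
    by (intro nn_integral_cong) (auto simp: indicator_def)
  then show ?thesis
    by (simp add: nn_integral_cmult measure_pmf.emeasure_eq_measure mult.commute)
qed

lemma space_iid [simp]: "space (iid D) = UNIV"
  by (simp add: space_PiM)

lemma sets_cylinder [measurable]: "{x. \<forall>j<L. x j = y j} \<in> sets (iid D)"
proof -
  have "{x \<in> space (iid D). \<forall>j<L. x j = y j} \<in> sets (iid D)" by measurable
  then show ?thesis by simp
qed

lemma emeasure_iid_cylinder:
  "emeasure (iid D) {x. \<forall>j<L. x j = y j} = ennreal (\<Prod>j<L. pmf D (y j))"
proof (induction L arbitrary: y)
  case 0
  interpret prob_space "iid D" by (rule prob_space_iid)
  show ?case using emeasure_space_1 by (simp add: space_PiM)
next
  case (Suc L)
  have "emeasure (iid D) {x. \<forall>j<Suc L. x j = y j} = (\<integral>\<^sup>+x. of_bool (\<forall>j<Suc L. x j = y j) \<partial>iid D)"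
    unfolding nn_integral_indicator[OF sets_cylinder, symmetric]
    by (intro nn_integral_cong) (simp add: indicator_def of_bool_def)
  also have "\<dots> = (\<integral>\<^sup>+d. (\<integral>\<^sup>+x. of_bool (\<forall>j<Suc L. case_nat d x j = y j) \<partial>iid D) \<partial>measure_pmf D)"
    by (rule nn_integral_iid) simp
  also have "\<dots> = (\<integral>\<^sup>+d. of_bool (d = y 0) * emeasure (iid D) {x. \<forall>j<L. x j = y (Suc j)} \<partial>measure_pmf D)"
  proof (intro nn_integral_cong)
    fix d
    have "(\<integral>\<^sup>+x. of_bool (\<forall>j<Suc L. case_nat d x j = y j) \<partial>iid D) =
      (\<integral>\<^sup>+x. of_bool (d = y 0) * indicator {x. \<forall>j<L. x j = y (Suc j)} x \<partial>iid D)"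
      by (intro nn_integral_cong) (auto simp: All_less_Suc2 indicator_def)
    also have "\<dots> = of_bool (d = y 0) * emeasure (iid D) {x. \<forall>j<L. x j = y (Suc j)}"
      by (subst nn_integral_cmult) (auto simp: space_PiM)
    finally show "(\<integral>\<^sup>+x. of_bool (\<forall>j<Suc L. case_nat d x j = y j) \<partial>iid D) =
      of_bool (d = y 0) * emeasure (iid D) {x. \<forall>j<L. x j = y (Suc j)}" .
  qed
  also have "\<dots> = ennreal (\<Prod>j<Suc L. pmf D (y j))"
    unfolding nn_integral_pmf_of_bool Suc.IH prod.lessThan_Suc_shift
    by (simp add: measure_pmf_single ennreal_mult prod_nonneg)
  finally show ?case .
qed

definition agrees :: "nat \<Rightarrow> bool list \<Rightarrow> (nat \<Rightarrow> trit) \<Rightarrow> (nat \<Rightarrow> trit) \<Rightarrow> (nat \<Rightarrow> bool) \<Rightarrow>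
    (nat \<Rightarrow> trit) \<Rightarrow> bool" where
  "agrees L w x y s t \<longleftrightarrow> (\<forall>j<L. emit j w x s t = y j)"

lemma agrees_0 [simp]: "agrees 0 w x y s t"
  by (simp add: agrees_def)

lemma agrees_Suc: "agrees (Suc L) w x y s t \<longleftrightarrow> (if hd w
    then widen (x 0) (s 0) = y 0 \<and>
      agrees L (next_tags w (x 0) (y 0)) (\<lambda>i. x (Suc i)) (\<lambda>i. y (Suc i)) (\<lambda>i. s (Suc i)) t
    else t 0 = y 0 \<and> agrees L (next_tags w (x 0) (y 0)) x (\<lambda>i. y (Suc i)) s (\<lambda>i. t (Suc i)))"
  unfolding agrees_def All_less_Suc2 by auto

lemma measurable_agrees [measurable]:
  "Measurable.pred (iid D \<Otimes>\<^sub>M iid T) (\<lambda>\<omega>. agrees L w x y (\<lambda>i. h (fst \<omega> i)) (snd \<omega>))"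
proof (induction L arbitrary: w x y)
  case (Suc L)
  have "(\<lambda>\<omega>. (\<lambda>i. fst \<omega> (Suc i), snd \<omega>)) \<in> measurable (iid D \<Otimes>\<^sub>M iid T) (iid D \<Otimes>\<^sub>M iid T)"
    by (intro measurable_Pair measurable_compose[OF measurable_fst measurable_iid_shift] measurable_snd)
  from measurable_compose[OF this Suc.IH]
  have 1: "Measurable.pred (iid D \<Otimes>\<^sub>M iid T)
      (\<lambda>\<omega>. agrees L w x y (\<lambda>i. h (fst \<omega> (Suc i))) (snd \<omega>))" for w x y
    unfolding fst_conv snd_conv .
  have "(\<lambda>\<omega>. (fst \<omega>, \<lambda>i. snd \<omega> (Suc i))) \<in> measurable (iid D \<Otimes>\<^sub>M iid T) (iid D \<Otimes>\<^sub>M iid T)"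
    by (intro measurable_Pair measurable_compose[OF measurable_snd measurable_iid_shift] measurable_fst)
  from measurable_compose[OF this Suc.IH]
  have 2: "Measurable.pred (iid D \<Otimes>\<^sub>M iid T)
      (\<lambda>\<omega>. agrees L w x y (\<lambda>i. h (fst \<omega> i)) (\<lambda>i. snd \<omega> (Suc i)))" for w x y
    unfolding fst_conv snd_conv .
  have 3: "Measurable.pred (iid D \<Otimes>\<^sub>M iid T) (\<lambda>\<omega>. P (fst \<omega> 0))" for P
    by (intro measurable_compose[OF measurable_compose[OF measurable_fst measurable_iid_component]]) simp
  have 4: "Measurable.pred (iid D \<Otimes>\<^sub>M iid T) (\<lambda>\<omega>. P (snd \<omega> 0))" for P
    by (intro measurable_compose[OF measurable_compose[OF measurable_snd measurable_iid_component]]) simp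
  show ?case
  proof (cases "hd w")
    case True
    show ?thesis
      unfolding agrees_Suc if_P[OF True]
      by (rule pred_intros_logic(3)[OF 3[of "\<lambda>v. widen (x 0) (h v) = y 0"] 1])
  next
    case False
    show ?thesis
      unfolding agrees_Suc if_not_P[OF False]
      by (rule pred_intros_logic(3)[OF 4[of "\<lambda>c. c = y 0"] 2])
  qed
qed simp

lemma sets_agrees:
  "{\<omega>. agrees L w x y (\<lambda>i. h (fst \<omega> i)) (snd \<omega>)} \<in> sets (iid D \<Otimes>\<^sub>M iid T)"
  using predE[OF measurable_agrees[where h = h]] by (simp add: space_pair_measure)

text \<open>The stream \<open>t\<close> is integrated inside and the choices outside; each step
  contributes the probability of one fresh draw from one of the two. \<open>D\<close> and
  \<open>h\<close> stay general because all codes live on one sample space and differ only in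
  \<open>h\<close>.\<close>

lemma emeasure_agrees:
  fixes D :: "'b pmf" and h :: "'b \<Rightarrow> bool" and T :: "trit pmf"
  defines "K \<equiv> \<lambda>a c. measure_pmf.prob D {v. widen a (h v) = c}"
  shows "emeasure (iid D \<Otimes>\<^sub>M iid T) {\<omega>. agrees L w x y (\<lambda>i. h (fst \<omega> i)) (snd \<omega>)} =
    ennreal (weight K (pmf T) L w x y)"
proof -
  interpret S: prob_space "iid D" by (rule prob_space_iid)
  interpret T: prob_space "iid T" by (rule prob_space_iid)
  have nonneg: "0 \<le> weight K (pmf T) L w x y" for L w x y
    unfolding weight_eq_prod K_def by (intro prod_nonneg) (auto split: prod.split)
  have ag [measurable]: "Measurable.pred (iid T) (agrees L w x y (\<lambda>i. h (s i)))"
    if "s \<in> space (iid D)" for L w x y s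
    using measurable_compose[OF measurable_Pair1'[OF that] measurable_agrees[where D = D and T = T and L = L and w = w and x = x and y = y and h = h]]
    by (simp only: fst_conv snd_conv)
  define I where "I L w x y s = (\<integral>\<^sup>+t. of_bool (agrees L w x y (\<lambda>i. h (s i)) t) \<partial>iid T)" for L w x y s
  have I_meas [measurable]: "I L w x y \<in> borel_measurable (iid D)" for L w x y
    unfolding I_def
  proof (rule T.borel_measurable_nn_integral)
    have "(\<lambda>\<omega>. of_bool (agrees L w x y (\<lambda>i. h (fst \<omega> i)) (snd \<omega>)) :: ennreal) \<in>
        borel_measurable (iid D \<Otimes>\<^sub>M iid T)"
      by (rule measurable_compose[OF measurable_agrees]) simp
    then show "(\<lambda>(s, t). of_bool (agrees L w x y (\<lambda>i. h (s i)) t) :: ennreal) \<in>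
        borel_measurable (iid D \<Otimes>\<^sub>M iid T)"
      unfolding split_beta .
  qed
  have "(\<integral>\<^sup>+s. I L w x y s \<partial>iid D) = ennreal (weight K (pmf T) L w x y)"
  proof (induction L arbitrary: w x y)
    case 0
    show ?case
      using S.emeasure_space_1 T.emeasure_space_1 by (simp add: I_def)
  next
    case (Suc L)
    let ?w = "next_tags w (x 0) (y 0)"
    show ?case
    proof (cases "hd w")
      case True
      have "I (Suc L) w x y (case_nat d s) = of_bool (widen (x 0) (h d) = y 0) *
          I L ?w (\<lambda>i. x (Suc i)) (\<lambda>i. y (Suc i)) s" for d s
        unfolding I_def agrees_Suc using True
        by (cases "widen (x 0) (h d) = y 0") simp_all
      then show ?thesis
        using True by (subst nn_integral_iid)
          (simp_all add: nn_integral_cmult Suc.IH nn_integral_pmf_of_bool K_def[symmetric]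
            ennreal_mult nonneg, simp add: K_def ennreal_mult nonneg[unfolded K_def])
    next
      case False
      have "I (Suc L) w x y s = ennreal (pmf T (y 0)) * I L ?w x (\<lambda>i. y (Suc i)) s" for s
      proof -
        have "I (Suc L) w x y s = (\<integral>\<^sup>+c. (\<integral>\<^sup>+t. of_bool (agrees (Suc L) w x y (\<lambda>i. h (s i)) (case_nat c t)) \<partial>iid T) \<partial>measure_pmf T)"
          unfolding I_def
          by (rule nn_integral_iid, rule measurable_compose[OF ag]) simp_all
        also have "\<dots> = (\<integral>\<^sup>+c. of_bool (c = y 0) * I L ?w x (\<lambda>i. y (Suc i)) s \<partial>measure_pmf T)"
          unfolding I_def agrees_Suc using False
          by (intro nn_integral_cong) simp
        finally show ?thesis
          by (simp add: nn_integral_pmf_of_bool measure_pmf_single)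
      qed
      then show ?thesis
        using False by (simp add: nn_integral_cmult Suc.IH ennreal_mult nonneg)
    qed
  qed
  moreover have "emeasure (iid D \<Otimes>\<^sub>M iid T) {\<omega>. agrees L w x y (\<lambda>i. h (fst \<omega> i)) (snd \<omega>)} =
      (\<integral>\<^sup>+s. I L w x y s \<partial>iid D)"
    unfolding I_def
    by (subst T.emeasure_pair_measure[OF sets_agrees])
      (simp add: indicator_def of_bool_def)
  ultimately show ?thesis by simp
qed

lemma measurable_weight [measurable]:
  "(\<lambda>x. weight K q L w x y) \<in> borel_measurable (iid D)"
  for K :: "trit \<Rightarrow> trit \<Rightarrow> real"
proof (induction L arbitrary: w y)
  case (Suc L)
  have cnt: "countable (UNIV :: trit set)"
    by (rule countable_subset[of _ "{T0, T1, T2}"]) (auto intro: trit.exhaust)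
  have K: "(\<lambda>x. K (x 0) c) \<in> borel_measurable (iid D)" for c
    by (rule measurable_compose[OF measurable_iid_component]) simp
  have 1: "(\<lambda>x. weight K q L (next_tags w (x 0) (y 0)) (\<lambda>i. x (Suc i)) (\<lambda>i. y (Suc i)))
      \<in> borel_measurable (iid D)"
    by (rule measurable_compose_countable'[OF _ measurable_iid_component[of 0] cnt])
       (rule measurable_compose[OF measurable_iid_shift Suc.IH])
  have 2: "(\<lambda>x. weight K q L (next_tags w (x 0) (y 0)) x (\<lambda>i. y (Suc i)))
      \<in> borel_measurable (iid D)"
    by (rule measurable_compose_countable'[OF _ measurable_iid_component[of 0] cnt]) (rule Suc.IH)
  show ?case
    using K 1 2 by (cases "hd w") simp_all
qed simp

text \<open>The next queue depends on the symbol of \<open>x\<close>, but the induction hypothesis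
  has the same value for every queue. So after integrating out the tail only the one-step average
  \<open>Kq\<close> remains.\<close>

lemma nn_integral_weight:
  fixes K :: "trit \<Rightarrow> trit \<Rightarrow> real"
  assumes K: "\<And>a c. 0 \<le> K a c" and q: "\<And>c. 0 \<le> q c"
    and Kq: "\<And>c. (\<integral>\<^sup>+a. ennreal (K a c) \<partial>measure_pmf D) = ennreal (q c)"
  shows "(\<integral>\<^sup>+x. ennreal (weight K q L w x y) \<partial>iid D) = ennreal (\<Prod>j<L. q (y j))"
proof (induction L arbitrary: w y)
  case 0
  interpret prob_space "iid D" by (rule prob_space_iid)
  show ?case using emeasure_space_1 by simp
next
  case (Suc L)
  have nonneg: "0 \<le> weight K q L w x y" for L w x y
    unfolding weight_eq_prod using K q by (intro prod_nonneg) (auto split: prod.split)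
  show ?case
  proof (cases "hd w")
    case True
    have "(\<integral>\<^sup>+x. ennreal (weight K q (Suc L) w (case_nat a x) y) \<partial>iid D) =
      ennreal (K a (y 0)) * ennreal (\<Prod>j<L. q (y (Suc j)))" for a
      using True K by (simp add: ennreal_mult nonneg nn_integral_cmult Suc.IH)
    then show ?thesis
      by (subst nn_integral_iid[OF measurable_compose[OF measurable_weight measurable_ennreal]])
        (simp_all add: nn_integral_multc Kq prod.lessThan_Suc_shift ennreal_mult prod_nonneg q
          del: prod.lessThan_Suc weight.simps)
  next
    case False
    \<comment> \<open>Children of a node outside the tree of \<open>x\<close> are tagged false
      whatever symbol is passed; the placeholder \<open>T0\<close> removes \<open>x 0\<close> from
      the integrand.\<close>
    then have w: "next_tags w a c = next_tags w T0 c" for a c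
      by (simp add: next_tags_def)
    have "ennreal (weight K q (Suc L) w x y) =
        ennreal (q (y 0)) * ennreal (weight K q L (next_tags w T0 (y 0)) x (\<lambda>i. y (Suc i)))" for x
      using False by (simp add: ennreal_mult nonneg q w[of "x 0"])
    then show ?thesis
      by (simp only: nn_integral_cmult[OF measurable_compose[OF measurable_weight measurable_ennreal]]
          Suc.IH prod.lessThan_Suc_shift ennreal_mult prod_nonneg q)
  qed
qed

section \<open>Rational approximation of the transition probabilities\<close>

text \<open>A left-c.e. real, restricted to nonnegative rationals: those below it are enumerated by
  the search for a witness \<open>i\<close> of the decidable relation \<open>R\<close>.\<close>

definition lower_ce :: "real \<Rightarrow> bool" where
  "lower_ce \<alpha> \<longleftrightarrow> (\<exists>R. decidable_in (\<lambda>_. 0) (\<lambda>v. R (pfst v) (pfst (psnd v)) (psnd (psnd v))) \<and>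
     (\<forall>c d. 0 < d \<longrightarrow> (real c / real d < \<alpha> \<longleftrightarrow> (\<exists>i. R c d i))))"

lemma lower_ceI:
  assumes "decidable_in (\<lambda>_. 0) (\<lambda>v. R (pfst v) (pfst (psnd v)) (psnd (psnd v)))"
    and "\<And>c d. 0 < d \<Longrightarrow> real c / real d < \<alpha> \<longleftrightarrow> (\<exists>i. R c d i)"
  shows "lower_ce \<alpha>"
  using assms unfolding lower_ce_def by blast

lemma computable_real_bounds:
  assumes "computable_real p" "0 < p"
  obtains l h e where "computable_in (\<lambda>_. 0) l" "computable_in (\<lambda>_. 0) h" "computable_in (\<lambda>_. 0) e"
    "\<And>i. 0 < e i" "\<And>i. real (l i) / real (e i) < p" "\<And>i. p < real (h i) / real (e i)"
    "(\<lambda>i. real (l i) / real (e i)) \<longlonglongrightarrow> p" "(\<lambda>i. real (h i) / real (e i)) \<longlonglongrightarrow> p"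
proof -
  obtain a b where ab: "computable_in (\<lambda>_. 0) a" "computable_in (\<lambda>_. 0) b"
    and ap: "\<And>i. \<bar>p - real_of_int (int_decode (a i)) / real (Suc (b i))\<bar> \<le> 1 / 2 ^ i"
    using assms(1) unfolding computable_real_def by blast
  \<comment> \<open>\<^const>\<open>int_decode\<close> maps exactly the even numbers to nonnegative integers.\<close>
  define A where "A i = (if a i mod 2 = 0 then a i div 2 else 0)" for i
  define B where "B i = Suc (b i)" for i
  \<comment> \<open>The margin \<open>2 / 2 ^ i\<close> is twice the error of the approximation,
    which makes both bounds strict. Truncating the lower one at 0 keeps it below \<open>p\<close>,
    because \<open>p\<close> is positive.\<close>
  define l where "l i = A i * 2 ^ i - 2 * B i" for i
  define h where "h i = A i * 2 ^ i + 2 * B i" for i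
  define e where "e i = B i * 2 ^ i" for i
  have comp: "computable_in (\<lambda>_. 0) l" "computable_in (\<lambda>_. 0) h" "computable_in (\<lambda>_. 0) e"
    unfolding l_def h_def e_def A_def B_def by (intro computable_intros ab)+
  have B: "0 < B i" for i by (simp add: B_def)
  have e: "0 < e i" for i by (simp add: e_def B_def)
  have A: "real (A i) = max 0 (real_of_int (int_decode (a i)))" for i
    by (auto simp: A_def int_decode_def sum_decode_def even_iff_mod_2_eq_zero)
  have p: "\<bar>p - real (A i) / real (B i)\<bar> \<le> 1 / 2 ^ i" for i
  proof (cases "0 \<le> int_decode (a i)")
    case True
    then show ?thesis using ap[of i] by (simp add: A B_def)
  next
    case False
    then have "real_of_int (int_decode (a i)) / real (Suc (b i)) \<le> 0"
      by (simp add: divide_nonpos_pos)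
    then show ?thesis using ap[of i] False assms(2) by (simp add: A B_def)
  qed
  have h: "real (h i) / real (e i) = real (A i) / real (B i) + 2 / 2 ^ i" for i
    using B[of i] by (simp add: h_def e_def field_simps)
  have l: "real (l i) / real (e i) = max 0 (real (A i) / real (B i) - 2 / 2 ^ i)" for i
  proof (cases "2 * B i \<le> A i * 2 ^ i")
    case True
    then have "real (2 * B i) \<le> real (A i * 2 ^ i)"
      by (simp only: of_nat_le_iff)
    then have "2 / 2 ^ i \<le> real (A i) / real (B i)"
      using B[of i] by (simp add: field_simps)
    moreover have "real (l i) / real (e i) = real (A i) / real (B i) - 2 / 2 ^ i"
      using True B[of i] by (simp add: l_def e_def of_nat_diff field_simps)
    ultimately show ?thesis by simp
  next
    case False
    then have "real (A i * 2 ^ i) \<le> real (2 * B i)" by (simp only: of_nat_le_iff)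
    then have "real (A i) / real (B i) \<le> 2 / 2 ^ i"
      using B[of i] by (simp add: field_simps)
    with False show ?thesis by (simp add: l_def)
  qed
  have pos: "0 < 1 / (2::real) ^ i" for i by simp
  have two: "2 / (2::real) ^ i = 1 / 2 ^ i + 1 / 2 ^ i" for i by simp
  have "real (A i) / real (B i) - 2 / 2 ^ i < p" "p < real (A i) / real (B i) + 2 / 2 ^ i" for i
    using p[of i] pos[of i] unfolding two abs_le_iff by linarith+
  then have "real (l i) / real (e i) < p" "p < real (h i) / real (e i)" for i
    using assms(2) unfolding h l by auto
  moreover have lim: "(\<lambda>i. c / 2 ^ i) \<longlonglongrightarrow> 0" for c :: real
    by real_asymp
  have AB: "(\<lambda>i. real (A i) / real (B i)) \<longlonglongrightarrow> p"
    by (rule LIM_zero_cancel, rule Lim_null_comparison[OF _ lim[of 1]])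
       (use p in \<open>auto simp: abs_minus_commute\<close>)
  have "(\<lambda>i. real (h i) / real (e i)) \<longlonglongrightarrow> p"
    unfolding h using tendsto_add[OF AB lim[of 2]] by simp
  moreover have "(\<lambda>i. real (l i) / real (e i)) \<longlonglongrightarrow> p"
    unfolding l using tendsto_max[OF tendsto_const[of 0] tendsto_diff[OF AB lim[of 2]]] assms(2) by simp
  ultimately show ?thesis
    using that[OF comp e] by blast
qed

lemma frac_less_iff:
  "0 < e \<Longrightarrow> 0 < d \<Longrightarrow> real a / real e < real b / real d \<longleftrightarrow> a * d < b * e"
  by (simp add: field_simps flip: of_nat_mult)

locale root_split =
  fixes p q :: real and n :: nat
  assumes p_pos: "0 < p" and p_half: "p \<le> 1 / 2" and p_comp: "computable_real p"
    and n: "2 \<le> n" and q_eq: "q = 1 - root n (1 - p)"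
begin

lemma power_q: "(1 - q) ^ n = 1 - p"
  using n p_half by (simp add: q_eq)

lemma q_pos: "0 < q"
  using n p_pos p_half by (simp add: q_eq)

lemma q_less_1: "q < 1"
  using n p_pos p_half by (simp add: q_eq)

lemma q_less_p: "q < p"
  using power_strict_decreasing[of 1 n "1 - q"] n q_pos q_less_1 power_q by simp

text \<open>Bernoulli's inequality for \<open>(1 - q) ^ n = 1 - p\<close>. It says that the
  \<open>n\<close> repetition probabilities \<open>q / p\<close> sum to at least 1, as a coupling
  with full coverage requires.\<close>

lemma p_le: "p \<le> real n * q"
  using Bernoulli_inequality[of "- q" n] q_less_1 power_q by simp

text \<open>Removes the root: comparing a rational with \<open>q\<close> becomes comparing its power
  with \<open>1 - p\<close>. The bound on \<open>w\<close> keeps the base nonnegative.\<close>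

lemma less_q_iff: "w \<le> 1 \<Longrightarrow> w < q \<longleftrightarrow> 1 - p < (1 - w) ^ n"
  using power_less_imp_less_base[of "1 - q" n "1 - w"] power_strict_mono[of "1 - q" "1 - w" n]
    q_less_1 n unfolding power_q by auto

lemma q_less_iff: "w \<le> 1 \<Longrightarrow> q < w \<longleftrightarrow> (1 - w) ^ n < 1 - p"
  using power_less_imp_less_base[of "1 - w" n "1 - q"] power_strict_mono[of "1 - w" "1 - q" n]
    q_less_1 n unfolding power_q by auto

text \<open>Each comparison turns into a strict inequality between a power and \<open>1 - p\<close>.
  The relation \<open>R\<close> tests it with \<open>p\<close> replaced by rational bounds on the
  unfavourable side: success at one stage proves the inequality, and a true strict inequality
  succeeds at a late stage by convergence.\<close>

lemma lower_ce_factors: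
  "lower_ce q" "lower_ce (1 - 2 * q)" "lower_ce (q / p)" "lower_ce (1 - q / p)"
proof -
  obtain l h e where comp: "computable_in (\<lambda>_. 0) l" "computable_in (\<lambda>_. 0) h" "computable_in (\<lambda>_. 0) e"
    and e: "\<And>i. 0 < e i" and l: "\<And>i. real (l i) / real (e i) < p"
    and h: "\<And>i. p < real (h i) / real (e i)"
    and liml: "(\<lambda>i. real (l i) / real (e i)) \<longlonglongrightarrow> p"
    and limh: "(\<lambda>i. real (h i) / real (e i)) \<longlonglongrightarrow> p"
    by (rule computable_real_bounds[OF p_comp p_pos]) (rule that; assumption)
  note comp' = comp(1)[THEN computable_in.comp, of "\<lambda>v. psnd (psnd v)"] comp(2)[THEN computable_in.comp, of "\<lambda>v. psnd (psnd v)"]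
    comp(3)[THEN computable_in.comp, of "\<lambda>v. psnd (psnd v)"]
  have le: "l i < e i" for i
  proof -
    have "real (l i) / real (e i) < 1" using l[of i] p_half by simp
    then show ?thesis using e[of i] by simp
  qed
  have el: "real (e i - l i) / real (e i) = 1 - real (l i) / real (e i)" for i
    using le[of i] by (simp add: of_nat_diff diff_divide_distrib less_imp_le)
  \<comment> \<open>Subtraction of naturals truncates, whence the maximum. Since
    \<open>1 - h / e\<close> is only compared with nonnegative powers below it, truncation cannot
    create a false success.\<close>
  have eh: "real (e i - h i) / real (e i) = max 0 (1 - real (h i) / real (e i))" for i
    using e[of i] by (cases "h i \<le> e i") (auto simp: of_nat_diff diff_divide_distrib)
  have ex: "\<exists>i. P i" if "eventually P sequentially" for P :: "nat \<Rightarrow> bool"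
    using that by (rule eventually_happens'[OF sequentially_bot])
  show "lower_ce q"
  proof (rule lower_ceI[where R = "\<lambda>c d i. c \<le> d \<and> (e i - l i) * d ^ n < (d - c) ^ n * e i"], goal_cases)
    case 1
    show ?case by (intro computable_intros comp')
  next
    case (2 c d)
    then have d: "0 < d" .
    let ?w = "real c / real d"
    have iff: "(c \<le> d \<and> (e i - l i) * d ^ n < (d - c) ^ n * e i) \<longleftrightarrow>
        ?w \<le> 1 \<and> 1 - real (l i) / real (e i) < (1 - ?w) ^ n" for i
    proof (cases "c \<le> d")
      case True
      then have "(1 - ?w) ^ n = real ((d - c) ^ n) / real (d ^ n)"
        using d by (simp add: of_nat_diff diff_divide_distrib flip: power_divide)
      then show ?thesis
        using True d e[of i] frac_less_iff[of "e i" "d ^ n" "e i - l i" "(d - c) ^ n"]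
        unfolding el[symmetric] by simp
    qed (use d in simp)
    show "?w < q \<longleftrightarrow> (\<exists>i. c \<le> d \<and> (e i - l i) * d ^ n < (d - c) ^ n * e i)"
      unfolding iff
    proof
      assume w: "?w < q"
      then have w1: "?w \<le> 1" using q_less_1 by simp
      with w have "1 - p < (1 - ?w) ^ n" by (simp only: less_q_iff)
      from order_tendstoD(2)[OF tendsto_diff[OF tendsto_const liml] this]
      show "\<exists>i. ?w \<le> 1 \<and> 1 - real (l i) / real (e i) < (1 - ?w) ^ n"
        using w1 by (auto dest: ex)
    next
      assume "\<exists>i. ?w \<le> 1 \<and> 1 - real (l i) / real (e i) < (1 - ?w) ^ n"
      then obtain i where "?w \<le> 1" "1 - real (l i) / real (e i) < (1 - ?w) ^ n" by blast
      then show "?w < q" using l[of i] by (simp only: less_q_iff)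
    qed
  qed
  show "lower_ce (1 - 2 * q)"
  \<comment> \<open>\<open>w < 1 - 2 * q\<close> means \<open>q < (1 - w) / 2\<close>, so the base
    of the power is \<open>(1 + w) / 2\<close>, that is \<open>(d + c) / (2 * d)\<close>.\<close>
  proof (rule lower_ceI[where R = "\<lambda>c d i. (d + c) ^ n * e i < (e i - h i) * (2 * d) ^ n"], goal_cases)
    case 1
    show ?case by (intro computable_intros comp')
  next
    case (2 c d)
    then have d: "0 < d" .
    let ?w = "real c / real d"
    have r: "?w < 1 - 2 * q \<longleftrightarrow> ((1 + ?w) / 2) ^ n < 1 - p" if "?w \<le> 1"
      using q_less_iff[of "(1 - ?w) / 2"] by (auto simp: field_simps)
    have "(1 + ?w) / 2 = real (d + c) / real (2 * d)"
      using d by (simp add: field_simps)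
    then have eq: "((1 + ?w) / 2) ^ n = real ((d + c) ^ n) / real ((2 * d) ^ n)"
      by (simp only: power_divide of_nat_power)
    have iff: "(d + c) ^ n * e i < (e i - h i) * (2 * d) ^ n \<longleftrightarrow>
        ((1 + ?w) / 2) ^ n < max 0 (1 - real (h i) / real (e i))" for i
      unfolding eq eh[symmetric] using d e[of i] by (subst frac_less_iff) auto
    show "?w < 1 - 2 * q \<longleftrightarrow> (\<exists>i. (d + c) ^ n * e i < (e i - h i) * (2 * d) ^ n)"
      unfolding iff
    proof
      assume w: "?w < 1 - 2 * q"
      then have "((1 + ?w) / 2) ^ n < 1 - p" using r q_pos by simp
      then have "((1 + ?w) / 2) ^ n < max 0 (1 - p)" using p_half by simp
      from order_tendstoD(1)[OF tendsto_max[OF tendsto_const tendsto_diff[OF tendsto_const limh]] this]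
      show "\<exists>i. ((1 + ?w) / 2) ^ n < max 0 (1 - real (h i) / real (e i))"
        by (rule ex)
    next
      assume "\<exists>i. ((1 + ?w) / 2) ^ n < max 0 (1 - real (h i) / real (e i))"
      then obtain i where i: "((1 + ?w) / 2) ^ n < max 0 (1 - real (h i) / real (e i))" ..
      have "0 \<le> ((1 + ?w) / 2) ^ n" by simp
      with i h[of i] have *: "((1 + ?w) / 2) ^ n < 1 - p" by linarith
      \<comment> \<open>A power below \<open>1 - p\<close> forces the base below 1, which puts
        \<open>?w\<close> in the range where \<open>r\<close> applies.\<close>
      have "(1 + ?w) / 2 < 1"
        using * p_pos power_less_imp_less_base[of "(1 + ?w) / 2" n 1] by simp
      then show "?w < 1 - 2 * q" using r * by simp
    qed
  qed
  have p1: "p < 1" using p_half by simp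
  show "lower_ce (q / p)"
  \<comment> \<open>The inequality is \<open>w * p < q\<close>. The upper bound replaces the
    \<open>p\<close> multiplied by \<open>w\<close> and the lower bound the one in
    \<open>1 - p\<close>; both make the test harder.\<close>
  proof (rule lower_ceI[where R = "\<lambda>c d i. c * h i \<le> d * e i \<and>
        (e i - l i) * (d * e i) ^ n < (d * e i - c * h i) ^ n * e i"], goal_cases)
    case 1
    show ?case by (intro computable_intros comp')
  next
    case (2 c d)
    then have d: "0 < d" .
    let ?w = "real c / real d"
    have r: "?w < q / p \<longleftrightarrow> 1 - p < (1 - ?w * p) ^ n" if "?w * p \<le> 1"
      using less_q_iff[OF that] p_pos by (simp add: pos_less_divide_eq)
    have iff: "(c * h i \<le> d * e i \<and> (e i - l i) * (d * e i) ^ n < (d * e i - c * h i) ^ n * e i) \<longleftrightarrow>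
        ?w * (real (h i) / real (e i)) \<le> 1 \<and>
        1 - real (l i) / real (e i) < (1 - ?w * (real (h i) / real (e i))) ^ n" for i
    proof (cases "c * h i \<le> d * e i")
      case True
      then have "1 - ?w * (real (h i) / real (e i)) = real (d * e i - c * h i) / real (d * e i)"
        using d e[of i] by (simp add: of_nat_diff field_simps)
      then have "(1 - ?w * (real (h i) / real (e i))) ^ n =
          real ((d * e i - c * h i) ^ n) / real ((d * e i) ^ n)"
        by (simp only: power_divide of_nat_power)
      moreover have "?w * (real (h i) / real (e i)) \<le> 1"
        using True d e[of i] by (simp add: field_simps flip: of_nat_mult)
      ultimately show ?thesis
        using True d e[of i] frac_less_iff[of "e i" "(d * e i) ^ n" "e i - l i" "(d * e i - c * h i) ^ n"]
        unfolding el[symmetric] by simp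
    next
      case False
      then have "\<not> ?w * (real (h i) / real (e i)) \<le> 1"
        using d e[of i] by (simp add: field_simps flip: of_nat_mult)
      with False show ?thesis by simp
    qed
    show "?w < q / p \<longleftrightarrow> (\<exists>i. c * h i \<le> d * e i \<and>
        (e i - l i) * (d * e i) ^ n < (d * e i - c * h i) ^ n * e i)"
      unfolding iff
    proof
      assume w: "?w < q / p"
      then have w1: "?w * p < 1" using q_less_1 p_pos by (simp add: pos_less_divide_eq)
      with w have "1 - p < (1 - ?w * p) ^ n" by (simp only: r less_imp_le)
      then have "0 < (1 - ?w * p) ^ n - (1 - p)" by simp
      moreover have "(\<lambda>i. (1 - ?w * (real (h i) / real (e i))) ^ n - (1 - real (l i) / real (e i)))
          \<longlonglongrightarrow> (1 - ?w * p) ^ n - (1 - p)"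
        by (intro tendsto_intros liml limh)
      ultimately have "eventually (\<lambda>i. 0 < (1 - ?w * (real (h i) / real (e i))) ^ n -
          (1 - real (l i) / real (e i))) sequentially"
        by (rule order_tendstoD(1)[rotated])
      moreover have "eventually (\<lambda>i. ?w * (real (h i) / real (e i)) < 1) sequentially"
        by (rule order_tendstoD(2)[OF tendsto_mult[OF tendsto_const limh] w1])
      ultimately have "eventually (\<lambda>i. ?w * (real (h i) / real (e i)) \<le> 1 \<and>
        1 - real (l i) / real (e i) < (1 - ?w * (real (h i) / real (e i))) ^ n) sequentially"
        by eventually_elim simp
      then show "\<exists>i. ?w * (real (h i) / real (e i)) \<le> 1 \<and>
        1 - real (l i) / real (e i) < (1 - ?w * (real (h i) / real (e i))) ^ n"
        by (rule ex)
    next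
      assume "\<exists>i. ?w * (real (h i) / real (e i)) \<le> 1 \<and>
        1 - real (l i) / real (e i) < (1 - ?w * (real (h i) / real (e i))) ^ n"
      then obtain i where i: "?w * (real (h i) / real (e i)) \<le> 1"
        "1 - real (l i) / real (e i) < (1 - ?w * (real (h i) / real (e i))) ^ n" by blast
      have wp: "?w * p \<le> ?w * (real (h i) / real (e i))"
        using h[of i] by (intro mult_left_mono) auto
      have "(1 - ?w * (real (h i) / real (e i))) ^ n \<le> (1 - ?w * p) ^ n"
        using wp i(1) by (intro power_mono) auto
      then show "?w < q / p"
        using r wp i l[of i] by linarith
    qed
  qed
  show "lower_ce (1 - q / p)"
  \<comment> \<open>The inequality is \<open>q < (1 - w) * p\<close>. Here the lower bound replaces
    \<open>p\<close> in the base, which enlarges the power, and the upper bound shrinks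
    \<open>1 - p\<close>.\<close>
  proof (rule lower_ceI[where R = "\<lambda>c d i. c \<le> d \<and>
        (d * e i - (d - c) * l i) ^ n * e i < (e i - h i) * (d * e i) ^ n"], goal_cases)
    case 1
    show ?case by (intro computable_intros comp')
  next
    case (2 c d)
    then have d: "0 < d" .
    let ?w = "real c / real d"
    have r: "?w < 1 - q / p \<longleftrightarrow> (1 - (1 - ?w) * p) ^ n < 1 - p"
    proof -
      have "0 \<le> ?w * p" using p_pos by simp
      then have "(1 - ?w) * p \<le> 1" using p1 by (simp add: algebra_simps)
      from q_less_iff[OF this] show ?thesis using p_pos by (simp add: field_simps)
    qed
    have iff: "(c \<le> d \<and> (d * e i - (d - c) * l i) ^ n * e i < (e i - h i) * (d * e i) ^ n) \<longleftrightarrow>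
        ?w \<le> 1 \<and> (1 - (1 - ?w) * (real (l i) / real (e i))) ^ n < max 0 (1 - real (h i) / real (e i))" for i
    proof (cases "c \<le> d")
      case True
      have "(d - c) * l i \<le> d * e i"
        using le[of i] by (intro mult_mono) auto
      then have "1 - (1 - ?w) * (real (l i) / real (e i)) =
          real (d * e i - (d - c) * l i) / real (d * e i)"
        using d e[of i] True by (simp add: of_nat_diff field_simps)
      then have "(1 - (1 - ?w) * (real (l i) / real (e i))) ^ n =
          real ((d * e i - (d - c) * l i) ^ n) / real ((d * e i) ^ n)"
        by (simp only: power_divide of_nat_power)
      then show ?thesis
        using True d e[of i] frac_less_iff[of "(d * e i) ^ n" "e i" "(d * e i - (d - c) * l i) ^ n" "e i - h i"]
        unfolding eh[symmetric] by simp
    qed (use d in simp)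
    show "?w < 1 - q / p \<longleftrightarrow> (\<exists>i. c \<le> d \<and>
        (d * e i - (d - c) * l i) ^ n * e i < (e i - h i) * (d * e i) ^ n)"
      unfolding iff
    proof
      assume w: "?w < 1 - q / p"
      have w1: "?w \<le> 1"
        using w q_pos p_pos divide_pos_pos[of q p] by linarith
      have "0 < (1 - p) - (1 - (1 - ?w) * p) ^ n"
        using w r by simp
      then have "(1 - (1 - ?w) * p) ^ n - max 0 (1 - p) < 0" using p1 by simp
      moreover have "(\<lambda>i. (1 - (1 - ?w) * (real (l i) / real (e i))) ^ n -
          max 0 (1 - real (h i) / real (e i))) \<longlonglongrightarrow> (1 - (1 - ?w) * p) ^ n - max 0 (1 - p)"
        by (intro tendsto_intros tendsto_max liml limh)
      ultimately have "eventually (\<lambda>i. (1 - (1 - ?w) * (real (l i) / real (e i))) ^ n -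
          max 0 (1 - real (h i) / real (e i)) < 0) sequentially"
        by (rule order_tendstoD(2)[rotated])
      from ex[OF this] w1 show "\<exists>i. ?w \<le> 1 \<and>
          (1 - (1 - ?w) * (real (l i) / real (e i))) ^ n < max 0 (1 - real (h i) / real (e i))"
        by auto
    next
      assume "\<exists>i. ?w \<le> 1 \<and>
          (1 - (1 - ?w) * (real (l i) / real (e i))) ^ n < max 0 (1 - real (h i) / real (e i))"
      then obtain i where w1: "?w \<le> 1"
        and i: "(1 - (1 - ?w) * (real (l i) / real (e i))) ^ n < max 0 (1 - real (h i) / real (e i))"
        by blast
      have a: "(1 - ?w) * (real (l i) / real (e i)) \<le> (1 - ?w) * p"
        using w1 l[of i] by (intro mult_left_mono) auto
      have b: "(1 - ?w) * p \<le> 1"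
        using w1 p_pos p1 by (intro mult_le_one) auto
      have "0 \<le> (1 - (1 - ?w) * p) ^ n"
        using b by simp
      moreover have "(1 - (1 - ?w) * p) ^ n \<le> (1 - (1 - ?w) * (real (l i) / real (e i))) ^ n"
        using a b by (intro power_mono) auto
      ultimately have "(1 - (1 - ?w) * p) ^ n < 1 - p"
        using i h[of i] by linarith
      then show "?w < 1 - q / p" using r by simp
    qed
  qed
qed

end

section \<open>Computing the weights\<close>

text \<open>Strings of length \<open>L\<close> are coded by the numbers below \<open>3 ^ L\<close>
  in base 3, lowest digit first. Digits beyond the string are 0, so a code also denotes an infinite
  sequence and serves directly as an argument of \<open>weight\<close> and
  \<open>hits\<close>.\<close>

definition digit :: "nat \<Rightarrow> nat \<Rightarrow> nat" where
  "digit e i = e div 3 ^ i mod 3"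

definition trit_of :: "nat \<Rightarrow> trit" where
  "trit_of k = (if k = 0 then T0 else if k = 1 then T1 else T2)"

definition digits :: "nat \<Rightarrow> nat \<Rightarrow> trit" where
  "digits e i = trit_of (digit e i)"

lemma digit_less [simp]: "digit e i < 3"
  by (simp add: digit_def)

lemma trit_code_trit_of: "k < 3 \<Longrightarrow> trit_code (trit_of k) = k"
  by (auto simp: trit_of_def)

lemma trit_of_trit_code [simp]: "trit_of (trit_code a) = a"
  by (cases a) (auto simp: trit_of_def)

lemma inj_trit_code: "inj trit_code"
  by (rule inj_on_inverseI[where g = trit_of]) simp

lemma trit_code_digits [simp]: "trit_code (digits e i) = digit e i"
  by (simp add: digits_def trit_code_trit_of)

lemma digit_Suc: "digit e (Suc i) = digit (e div 3) i"
  by (simp add: digit_def div_mult2_eq)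

lemma digits_exist: "\<exists>e<3 ^ L. \<forall>i<L. digits e i = y i"
proof (induction L arbitrary: y)
  case (Suc L)
  obtain e where e: "e < 3 ^ L" "\<forall>i<L. digits e i = y (Suc i)"
    using Suc.IH[of "\<lambda>i. y (Suc i)"] by blast
  define d where "d = trit_code (y 0)"
  have d: "d < 3" unfolding d_def by (cases "y 0") auto
  have "digits (3 * e + d) 0 = y 0"
    using d unfolding digits_def digit_def by (simp add: d_def)
  moreover have "digits (3 * e + d) (Suc i) = digits e i" for i
    using d by (simp add: digits_def digit_Suc)
  ultimately have "\<forall>i<Suc L. digits (3 * e + d) i = y i"
    using e(2) by (auto simp: All_less_Suc2)
  moreover have "3 * e + d < 3 ^ Suc L" using e(1) d by simp
  ultimately show ?case by blast
qed simp

lemma digits_unique: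
  "e < 3 ^ L \<Longrightarrow> e' < 3 ^ L \<Longrightarrow> (\<And>i. i < L \<Longrightarrow> digits e i = digits e' i) \<Longrightarrow> e = e'"
proof (induction L arbitrary: e e')
  case (Suc L)
  have dig: "digit e i = digit e' i" if "i < Suc L" for i
    using Suc.prems(3)[OF that] by (metis trit_code_digits)
  have "e div 3 = e' div 3"
  proof (rule Suc.IH)
    show "digits (e div 3) i = digits (e' div 3) i" if "i < L" for i
      using dig[of "Suc i"] that by (simp add: digits_def digit_Suc)
  qed (use Suc.prems(1,2) in auto)
  moreover have "e mod 3 = e' mod 3"
    using dig[of 0] by (simp add: digit_def)
  ultimately show ?case by (metis div_mult_mod_eq)
qed simp

definition prefix_code :: "(nat \<Rightarrow> trit) \<Rightarrow> nat \<Rightarrow> nat" where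
  "prefix_code y k = list_encode (map (\<lambda>i. trit_code (y i)) [0..<k])"

lemma coded_open_iff: "y \<in> coded_open W m \<longleftrightarrow> (\<exists>k. prod_encode (m, prefix_code y k) \<in> W)"
  by (simp add: coded_open_def prefix_code_def)

lemma prefix_code_cong: "(\<And>i. i < k \<Longrightarrow> x i = y i) \<Longrightarrow> prefix_code x k = prefix_code y k"
  unfolding prefix_code_def by (intro arg_cong[where f = list_encode] map_cong) auto

lemma prefix_code_eq_iff: "prefix_code x k = prefix_code y l \<longleftrightarrow> k = l \<and> (\<forall>i<k. x i = y i)"
proof -
  have "prefix_code x k = prefix_code y l \<longleftrightarrow>
      map (\<lambda>i. trit_code (x i)) [0..<k] = map (\<lambda>i. trit_code (y i)) [0..<l]"
    unfolding prefix_code_def by (simp add: list_encode_eq)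
  also have "\<dots> \<longleftrightarrow> k = l \<and> (\<forall>i<k. trit_code (x i) = trit_code (y i))"
    by (auto simp: list_eq_iff_nth_eq)
  finally show ?thesis by (simp add: inj_eq[OF inj_trit_code])
qed

lemma computable_digit:
  assumes "computable_in g f" "computable_in g h"
  shows "computable_in g (\<lambda>a. digit (f a) (h a))"
  unfolding digit_def by (intro computable_intros assms)

lemma computable_prefix_code:
  assumes "computable_in g f" "computable_in g h"
  shows "computable_in g (\<lambda>a. prefix_code (digits (f a)) (h a))"
proof -
  \<comment> \<open>\<open>list_encode\<close> is built from the tail, so the recursion prepends the
    symbols in the order \<open>k - 1\<close>, \<open>k - 2\<close> and so on.\<close>
  have "rec_nat 0 (\<lambda>i r. Suc (prod_encode (digit e (k - Suc i), r))) j =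
      list_encode (map (digit e) [k - j..<k])" if "j \<le> k" for e k j
    using that
  proof (induction j)
    case (Suc j)
    have "[k - Suc j..<k] = (k - Suc j) # [k - j..<k]"
      using Suc.prems by (simp add: upt_conv_Cons Suc_diff_Suc)
    with Suc show ?case by simp
  qed simp
  from this[OF order_refl] have *: "prefix_code (digits e) k =
      rec_nat 0 (\<lambda>i r. Suc (prod_encode (digit e (k - Suc i), r))) k" for e k
    by (simp add: prefix_code_def)
  show ?thesis
    unfolding * by (intro computable_rec computable_intros computable_digit
        computable_in.comp[OF assms(1)] computable_in.comp[OF assms(2)] assms)
qed

text \<open>The fractions \<open>c1/d\<close>, \<open>c2/d\<close>, \<open>c3/d\<close>, \<open>c4/d\<close> stand for \<open>q\<close>, \<open>1 - 2q\<close>, \<open>q/p\<close>, \<open>1 - q/p\<close>;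
  all factors are scaled by \<open>d\<close>.\<close>

definition nat_kernel :: "nat \<Rightarrow> nat \<Rightarrow> nat \<Rightarrow> trit \<Rightarrow> trit \<Rightarrow> nat" where
  "nat_kernel d c3 c4 a c = (if a = T2 then if c = T2 then d else 0
     else if c = a then c3 else if c = T2 then c4 else 0)"

definition nat_marginal :: "nat \<Rightarrow> nat \<Rightarrow> trit \<Rightarrow> nat" where
  "nat_marginal c1 c2 c = (if c = T2 then c2 else c1)"

text \<open>The queue of tags is coded by the number \<open>V\<close> whose lowest bit is its head, together with its
  length \<open>l\<close>.\<close>

definition tag_step :: "nat \<Rightarrow> nat \<Rightarrow> nat \<Rightarrow> nat \<Rightarrow> nat" where
  "tag_step V l a c = V div 2 + 2 ^ (l - 1) *
    (if V mod 2 = 0 then 0 else if c = 0 then if a = 1 then 0 else 1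
     else if c = 1 then if a = 0 then 0 else 1
     else (if a = 1 then 0 else 1) + (if a = 0 then 0 else 2))"

definition factor_step :: "nat \<Rightarrow> nat \<Rightarrow> nat \<Rightarrow> nat \<Rightarrow> nat \<Rightarrow> nat \<Rightarrow> nat \<Rightarrow> nat \<Rightarrow> nat" where
  "factor_step V a c d c1 c2 c3 c4 =
    (if V mod 2 = 0 then if c = 2 then c2 else c1
     else if a = 2 then if c = 2 then d else 0
     else if c = a then c3 else if c = 2 then c4 else 0)"

text \<open>The state holds the coded queue, its length, the number of symbols of \<open>x\<close>
  read and the product so far: the state of \<open>run\<close> in numbers, with an
  accumulator.\<close>

definition weight_step where
  "weight_step ex ey d c1 c2 c3 c4 j s = (let V = pfst s; l = pfst (psnd s);
      r = pfst (psnd (psnd s)); acc = psnd (psnd (psnd s)); a = digit ex r; c = digit ey j in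
    prod_encode (tag_step V l a c, prod_encode (l - 1 + (if c = 2 then 2 else 1),
      prod_encode (r + V mod 2, acc * factor_step V a c d c1 c2 c3 c4))))"

abbreviation bits :: "bool list \<Rightarrow> nat" where
  "bits w \<equiv> horner_sum of_bool 2 w"

lemma bits_mod_2: "w \<noteq> [] \<Longrightarrow> bits w mod 2 = of_bool (hd w)"
  by (cases w) auto

lemma bits_div_2: "w \<noteq> [] \<Longrightarrow> bits w div 2 = bits (tl w)"
  by (cases w) auto

lemma digit_cases: obtains "digit e i = 0" "digits e i = T0" | "digit e i = 1" "digits e i = T1"
  | "digit e i = 2" "digits e i = T2"
proof -
  consider "digit e i = 0" | "digit e i = 1" | "digit e i = 2"
    using digit_less[of e i] by linarith
  then show ?thesis
    by cases (use that in \<open>auto simp: digits_def trit_of_def\<close>)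
qed

text \<open>After the head is dropped, \<open>l - 1\<close> tags remain, so the tags of the children
  start at bit \<open>l - 1\<close>. The child along \<open>False\<close> is tagged unless
  \<open>a = 1\<close>, the one along \<open>True\<close> unless \<open>a = 0\<close>; if both
  children exist, the second has weight 2.\<close>

lemma tag_step_bits:
  assumes "w \<noteq> []"
  shows "tag_step (bits w) (length w) (digit ex r) (digit ey j) =
    bits (next_tags w (digits ex r) (digits ey j))"
  by (cases rule: digit_cases[of ex r]; cases rule: digit_cases[of ey j]; cases "hd w")
    (simp_all add: tag_step_def next_tags_def horner_sum_append bits_mod_2 bits_div_2 assms)

lemma factor_step_eq:
  assumes "w \<noteq> []"
  shows "factor_step (bits w) (digit ex r) (digit ey j) d c1 c2 c3 c4 =
    (if hd w then nat_kernel d c3 c4 (digits ex r) (digits ey j)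
     else nat_marginal c1 c2 (digits ey j))"
  by (cases rule: digit_cases[of ex r]; cases rule: digit_cases[of ey j]; cases "hd w")
    (simp_all add: factor_step_def nat_kernel_def nat_marginal_def bits_mod_2 assms)

lemma length_next_tags: "w \<noteq> [] \<Longrightarrow>
    length (next_tags w a (digits e j)) = length w - 1 + (if digit e j = 2 then 2 else 1)"
  by (cases rule: digit_cases[of e j]) (simp_all add: next_tags_def)

text \<open>The initial state codes the queue \<open>[True]\<close>, the root being a common node.
  Nonemptiness belongs to the invariant because only then do the lowest bit and the halved number
  represent head and tail.\<close>

lemma weight_step_rec:
  "rec_nat (prod_encode (1, prod_encode (1, prod_encode (0, 1)))) (weight_step ex ey d c1 c2 c3 c4) L =
    (case run [True] (digits ex) (digits ey) L of (w, r) \<Rightarrow>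
      prod_encode (bits w, prod_encode (length w, prod_encode (r,
        weight (nat_kernel d c3 c4) (nat_marginal c1 c2) L [True] (digits ex) (digits ey))))) \<and>
    fst (run [True] (digits ex) (digits ey) L) \<noteq> []"
proof (induction L)
  case (Suc L)
  obtain w r where wr: "run [True] (digits ex) (digits ey) L = (w, r)" by fastforce
  with Suc have w: "w \<noteq> []" by simp
  show ?case
    using Suc w unfolding weight_eq_prod
    by (simp add: wr weight_step_def tag_step_bits factor_step_eq length_next_tags bits_mod_2)
       (simp add: next_tags_def)
qed simp

lemma computable_weight:
  assumes "computable_in g ex" "computable_in g ey" "computable_in g L" "computable_in g d"
    "computable_in g c1" "computable_in g c2" "computable_in g c3" "computable_in g c4"
  shows "computable_in g (\<lambda>v. weight (nat_kernel (d v) (c3 v) (c4 v)) (nat_marginal (c1 v) (c2 v))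
    (L v) [True] (digits (ex v)) (digits (ey v)))"
proof -
  have *: "weight (nat_kernel d c3 c4) (nat_marginal c1 c2) L [True] (digits ex) (digits ey) =
    psnd (psnd (psnd (rec_nat (prod_encode (1, prod_encode (1, prod_encode (0, 1))))
      (weight_step ex ey d c1 c2 c3 c4) L)))" for ex ey d c1 c2 c3 c4 L
    using weight_step_rec[of ex ey d c1 c2 c3 c4 L]
    by (cases "run [True] (digits ex) (digits ey) L") simp
  show ?thesis
    unfolding * weight_step_def Let_def tag_step_def factor_step_def
    by (intro computable_rec computable_intros computable_digit assms assms[THEN computable_in.comp])
qed

section \<open>The induced Martin-Loef test\<close>

text \<open>Transition probability from a symbol of \<open>x\<close> to a symbol of \<open>y\<close>
  at a common node. For \<open>a = T2\<close> both terms fall on the same symbol and add up to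
  1.\<close>

definition kernel :: "real \<Rightarrow> trit \<Rightarrow> trit \<Rightarrow> real" where
  "kernel \<rho> a c = \<rho> * of_bool (c = a) + (1 - \<rho>) * of_bool (c = T2)"

lemma kernel_nonneg: "0 \<le> \<rho> \<Longrightarrow> \<rho> \<le> 1 \<Longrightarrow> 0 \<le> kernel \<rho> a c"
  by (simp add: kernel_def)

lemma prob_widen:
  assumes "measure_pmf.prob D {v. h v} = \<rho>"
  shows "measure_pmf.prob D {v. widen a (h v) = c} = kernel \<rho> a c"
proof -
  have "UNIV - {v. h v} = {v. \<not> h v}" by auto
  then have not_h: "measure_pmf.prob D {v. \<not> h v} = 1 - \<rho>"
    using measure_pmf.prob_compl[of "{v. h v}" D] assms by simp
  have "{v. widen a (h v) = c} = (if c = a then {v. h v} else {}) \<union> (if c = T2 then {v. \<not> h v} else {})"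
    by (auto simp: widen_def)
  moreover have "{v. h v} \<inter> {v. \<not> h v} = {}" by auto
  ultimately show ?thesis
    by (simp add: kernel_def assms not_h measure_pmf.finite_measure_Union)
qed

lemma UNIV_trit: "(UNIV :: trit set) = {T0, T1, T2}"
  using trit.exhaust by auto

text \<open>Stage \<open>L\<close> of the \<open>m\<close>-th open set, with both the enumeration
  and the prefix length cut off. It is decidable and depends only on the first \<open>L\<close>
  symbols of \<open>y\<close>.\<close>

definition hits :: "(nat \<Rightarrow> nat) \<Rightarrow> nat \<Rightarrow> nat \<Rightarrow> (nat \<Rightarrow> trit) \<Rightarrow> bool" where
  "hits f m L y \<longleftrightarrow> (\<exists>k<Suc L. \<exists>i<L. f i = prod_encode (m, prefix_code y k))"

lemma hits_cong: "(\<And>i. i < L \<Longrightarrow> x i = y i) \<Longrightarrow> hits f m L x \<longleftrightarrow> hits f m L y"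
  unfolding hits_def by (intro ex_cong1 conj_cong refl) (simp add: prefix_code_cong[of _ x y])

lemma hits_mono: "L \<le> L' \<Longrightarrow> hits f m L y \<Longrightarrow> hits f m L' y"
  unfolding hits_def by (meson Suc_le_mono order_less_le_trans)

lemma coded_open_hits: "y \<in> coded_open (range f) m \<longleftrightarrow> (\<exists>L. hits f m L y)"
proof
  assume "y \<in> coded_open (range f) m"
  then obtain k i where ki: "f i = prod_encode (m, prefix_code y k)"
    by (auto simp: coded_open_iff) metis
  have "k < Suc (max k (Suc i))" "i < max k (Suc i)" by auto
  with ki have "hits f m (max k (Suc i)) y"
    unfolding hits_def by blast
  then show "\<exists>L. hits f m L y" ..
next
  assume "\<exists>L. hits f m L y"
  then show "y \<in> coded_open (range f) m"
    unfolding hits_def coded_open_iff by (metis rangeI)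
qed

definition hit_codes :: "(nat \<Rightarrow> nat) \<Rightarrow> nat \<Rightarrow> nat \<Rightarrow> nat set" where
  "hit_codes f m L = {e. e < 3 ^ L \<and> hits f m L (digits e)}"

lemma finite_hit_codes [simp]: "finite (hit_codes f m L)"
  unfolding hit_codes_def by simp

lemma hits_iff_codes: "hits f m L y \<longleftrightarrow> (\<exists>e\<in>hit_codes f m L. \<forall>j<L. y j = digits e j)"
proof
  assume y: "hits f m L y"
  obtain e where e: "e < 3 ^ L" "\<forall>j<L. digits e j = y j"
    using digits_exist by blast
  then have "hits f m L (digits e)"
    using y hits_cong[of L "digits e" y] by auto
  with e show "\<exists>e\<in>hit_codes f m L. \<forall>j<L. y j = digits e j"
    unfolding hit_codes_def by (intro bexI[of _ e]) auto
next
  assume "\<exists>e\<in>hit_codes f m L. \<forall>j<L. y j = digits e j"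
  then obtain e where "hits f m L (digits e)" "\<forall>j<L. y j = digits e j"
    unfolding hit_codes_def by blast
  then show "hits f m L y"
    using hits_cong[of L y "digits e"] by auto
qed

lemma hit_codes_unique:
  "e \<in> hit_codes f m L \<Longrightarrow> e' \<in> hit_codes f m L \<Longrightarrow>
    \<forall>j<L. y j = digits e j \<Longrightarrow> \<forall>j<L. y j = digits e' j \<Longrightarrow> e = e'"
  by (rule digits_unique[of _ L]) (auto simp: hit_codes_def)

text \<open>A stage is a finite disjoint union of cylinders. The map \<open>Y\<close> is general
  because this serves both an independent sequence and an emitted code.\<close>

lemma emeasure_hits_vimage:
  assumes sets: "\<And>e. {\<omega>. \<forall>j<L. Y \<omega> j = digits e j} \<in> sets M"
    and meas: "\<And>e. emeasure M {\<omega>. \<forall>j<L. Y \<omega> j = digits e j} = ennreal (u e)"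
    and u: "\<And>e. 0 \<le> u e"
  shows "{\<omega>. hits f m L (Y \<omega>)} \<in> sets M"
    and "emeasure M {\<omega>. hits f m L (Y \<omega>)} = ennreal (\<Sum>e\<in>hit_codes f m L. u e)"
proof -
  have eq: "{\<omega>. hits f m L (Y \<omega>)} = (\<Union>e\<in>hit_codes f m L. {\<omega>. \<forall>j<L. Y \<omega> j = digits e j})"
    by (auto simp: hits_iff_codes)
  show "{\<omega>. hits f m L (Y \<omega>)} \<in> sets M"
    unfolding eq using sets by (intro sets.finite_UN) auto
  have "disjoint_family_on (\<lambda>e. {\<omega>. \<forall>j<L. Y \<omega> j = digits e j}) (hit_codes f m L)"
    unfolding disjoint_family_on_def using hit_codes_unique[of _ f m L] by blast
  then have "emeasure M {\<omega>. hits f m L (Y \<omega>)} =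
      (\<Sum>e\<in>hit_codes f m L. emeasure M {\<omega>. \<forall>j<L. Y \<omega> j = digits e j})"
    unfolding eq using sets by (subst sum_emeasure) auto
  also have "\<dots> = ennreal (\<Sum>e\<in>hit_codes f m L. u e)"
    unfolding meas using u by (rule sum_ennreal)
  finally show "emeasure M {\<omega>. hits f m L (Y \<omega>)} = ennreal (\<Sum>e\<in>hit_codes f m L. u e)" .
qed

context root_split
begin

lemma q_half: "q \<le> 1 / 2"
  using q_less_p p_half by simp

lemma ratio_pos: "0 < q / p" and ratio_less_1: "q / p < 1"
  using q_pos p_pos q_less_p by auto

text \<open>The one-step change of law: \<open>T0\<close> and \<open>T1\<close> receive
  \<open>p * (q / p) = q\<close> each, and \<open>T2\<close> receives
  \<open>1 - 2 * p + 2 * p * (1 - q / p) = 1 - 2 * q\<close>.\<close>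

lemma nn_integral_kernel:
  "(\<integral>\<^sup>+a. ennreal (kernel (q / p) a c) \<partial>measure_pmf (trit_pmf p)) = ennreal (pmf (trit_pmf q) c)"
proof -
  have "(\<integral>\<^sup>+a. ennreal (kernel (q / p) a c) \<partial>measure_pmf (trit_pmf p)) =
      (\<Sum>a\<in>UNIV. ennreal (pmf (trit_pmf p) a) * ennreal (kernel (q / p) a c))"
    unfolding nn_integral_measure_pmf
    by (rule nn_integral_count_space_finite) (simp add: UNIV_trit)
  also have "\<dots> = (\<Sum>a\<in>UNIV. ennreal (pmf (trit_pmf p) a * kernel (q / p) a c))"
    using ratio_pos ratio_less_1 by (simp add: ennreal_mult kernel_nonneg)
  also have "\<dots> = ennreal (\<Sum>a\<in>UNIV. pmf (trit_pmf p) a * kernel (q / p) a c)"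
    using ratio_pos ratio_less_1 by (intro sum_ennreal) (simp add: kernel_nonneg)
  also have "(\<Sum>a\<in>UNIV. pmf (trit_pmf p) a * kernel (q / p) a c) = pmf (trit_pmf q) c"
    using p_pos p_half q_pos q_half
    by (cases c) (simp_all add: UNIV_trit pmf_trit_pmf kernel_def algebra_simps)
  finally show ?thesis .
qed

abbreviation kweight :: "nat \<Rightarrow> (nat \<Rightarrow> trit) \<Rightarrow> (nat \<Rightarrow> trit) \<Rightarrow> real" where
  "kweight L x y \<equiv> weight (kernel (q / p)) (pmf (trit_pmf q)) L [True] x y"

lemma kweight_nonneg: "0 \<le> kweight L x y"
  unfolding weight_eq_prod using ratio_pos ratio_less_1
  by (intro prod_nonneg) (auto split: prod.split simp: kernel_nonneg)

text \<open>The conditional probability, given \<open>x\<close>, that \<open>y\<close> has entered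
  the \<open>m\<close>-th open set by stage \<open>L\<close>; its supremum over \<open>L\<close> is
  the conditional probability of the open set.\<close>

definition hit_prob :: "(nat \<Rightarrow> nat) \<Rightarrow> nat \<Rightarrow> nat \<Rightarrow> (nat \<Rightarrow> trit) \<Rightarrow> real" where
  "hit_prob f m L x = (\<Sum>e\<in>hit_codes f m L. kweight L x (digits e))"

lemma hit_prob_nonneg: "0 \<le> hit_prob f m L x"
  unfolding hit_prob_def by (intro sum_nonneg kweight_nonneg)

lemma measurable_hit_prob [measurable]: "hit_prob f m L \<in> borel_measurable (iid D)"
  unfolding hit_prob_def[abs_def] by (intro borel_measurable_sum measurable_weight)

lemma hits_emit:
  assumes "measure_pmf.prob D {v. h v} = q / p"
  shows "{\<omega>. hits f m L (\<lambda>j. emit j [True] x (\<lambda>i. h (fst \<omega> i)) (snd \<omega>))}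
      \<in> sets (iid D \<Otimes>\<^sub>M iid (trit_pmf q))"
    and "emeasure (iid D \<Otimes>\<^sub>M iid (trit_pmf q))
      {\<omega>. hits f m L (\<lambda>j. emit j [True] x (\<lambda>i. h (fst \<omega> i)) (snd \<omega>))} = ennreal (hit_prob f m L x)"
proof -
  have K: "(\<lambda>a c. measure_pmf.prob D {v. widen a (h v) = c}) = kernel (q / p)"
    using prob_widen[OF assms] by blast
  note sets = sets_agrees[unfolded agrees_def, where h = h]
    and meas = emeasure_agrees[unfolded agrees_def, where h = h and D = D, unfolded K]
  show "{\<omega>. hits f m L (\<lambda>j. emit j [True] x (\<lambda>i. h (fst \<omega> i)) (snd \<omega>))}
      \<in> sets (iid D \<Otimes>\<^sub>M iid (trit_pmf q))"
    by (rule emeasure_hits_vimage(1)[OF sets meas kweight_nonneg])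
  show "emeasure (iid D \<Otimes>\<^sub>M iid (trit_pmf q))
      {\<omega>. hits f m L (\<lambda>j. emit j [True] x (\<lambda>i. h (fst \<omega> i)) (snd \<omega>))} = ennreal (hit_prob f m L x)"
    unfolding hit_prob_def by (rule emeasure_hits_vimage(2)[OF sets meas kweight_nonneg])
qed

text \<open>The sums for different \<open>L\<close> range over different strings, so monotonicity is
  obtained by reading them as probabilities of growing events, on a space where each choice is one
  Bernoulli draw.\<close>

lemma hit_prob_mono:
  assumes "L \<le> L'" shows "hit_prob f m L x \<le> hit_prob f m L' x"
proof -
  let ?D = "bernoulli_pmf (q / p)"
  have "{v. v} = {True}" by auto
  then have "measure_pmf.prob ?D {v. v} = q / p"
    using ratio_pos ratio_less_1 by (simp add: measure_pmf_single)
  note D = hits_emit[OF this]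
  have "ennreal (hit_prob f m L x) \<le> ennreal (hit_prob f m L' x)"
    unfolding D(2)[symmetric] by (rule emeasure_mono[OF _ D(1)]) (use hits_mono[OF assms] in auto)
  then show ?thesis using hit_prob_nonneg by simp
qed

lemma
  fixes f :: "nat \<Rightarrow> nat"
  shows hits_iid: "{y. hits f m L y} \<in> sets (iid D)"
  and emeasure_hits_iid: "emeasure (iid D) {y. hits f m L y} =
    ennreal (\<Sum>e\<in>hit_codes f m L. \<Prod>j<L. pmf D (digits e j))"
  using emeasure_hits_vimage[of L "\<lambda>y. y", OF sets_cylinder emeasure_iid_cylinder]
  by (simp_all add: prod_nonneg)

lemma sets_coded_open:
  fixes f :: "nat \<Rightarrow> nat"
  shows "coded_open (range f) m \<in> sets (iid D)"
proof -
  have "coded_open (range f) m = (\<Union>L. {y. hits f m L y})"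
    using coded_open_hits by blast
  then show ?thesis using hits_iid by auto
qed

lemma nn_integral_hit_prob:
  "(\<integral>\<^sup>+x. ennreal (hit_prob f m L x) \<partial>iid (trit_pmf p)) \<le> emeasure (iid (trit_pmf q)) (coded_open (range f) m)"
proof -
  have "(\<integral>\<^sup>+x. ennreal (hit_prob f m L x) \<partial>iid (trit_pmf p)) =
      (\<integral>\<^sup>+x. (\<Sum>e\<in>hit_codes f m L. ennreal (kweight L x (digits e))) \<partial>iid (trit_pmf p))"
    unfolding hit_prob_def by (simp only: sum_ennreal kweight_nonneg)
  also have "\<dots> = (\<Sum>e\<in>hit_codes f m L. (\<integral>\<^sup>+x. ennreal (kweight L x (digits e)) \<partial>iid (trit_pmf p)))"
    by (rule nn_integral_sum) (rule measurable_compose[OF measurable_weight measurable_ennreal])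
  also have "\<dots> = (\<Sum>e\<in>hit_codes f m L. ennreal (\<Prod>j<L. pmf (trit_pmf q) (digits e j)))"
    using ratio_pos ratio_less_1
    by (intro sum.cong refl nn_integral_weight nn_integral_kernel kernel_nonneg pmf_nonneg) auto
  also have "\<dots> = emeasure (iid (trit_pmf q)) {y. hits f m L y}"
    unfolding emeasure_hits_iid by (intro sum_ennreal prod_nonneg) auto
  also have "\<dots> \<le> emeasure (iid (trit_pmf q)) (coded_open (range f) m)"
    by (rule emeasure_mono[OF _ sets_coded_open]) (auto simp: coded_open_hits)
  finally show ?thesis .
qed

text \<open>Using the test set of index \<open>2k\<close> with threshold \<open>2^(-k)\<close> leaves measure \<open>2^(-k)\<close> by Markov's
  inequality.\<close>

definition heavy :: "(nat \<Rightarrow> nat) \<Rightarrow> nat \<Rightarrow> (nat \<Rightarrow> trit) set" where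
  "heavy f k = {x. \<exists>L. 1 / 2 ^ k < hit_prob f (2 * k) L x}"

lemma sets_heavy_level: "{x. r < hit_prob f m L x} \<in> sets (iid D)"
proof -
  have "{x \<in> space (iid D). r < hit_prob f m L x} \<in> sets (iid D)"
    by (rule borel_measurable_less[OF borel_measurable_const measurable_hit_prob])
  then show ?thesis by simp
qed

lemma heavy_eq: "heavy f k = (\<Union>L. {x. 1 / 2 ^ k < hit_prob f (2 * k) L x})"
  by (auto simp: heavy_def)

lemma sets_heavy: "heavy f k \<in> sets (iid D)"
  unfolding heavy_eq using sets_heavy_level by auto

lemma measure_heavy:
  assumes "measure (bernoulli_measure q) (coded_open (range f) (2 * k)) \<le> 1 / 2 ^ (2 * k)"
  shows "measure (iid (trit_pmf p)) (heavy f k) \<le> 1 / 2 ^ k"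
proof -
  interpret P: prob_space "iid (trit_pmf p)" by (rule prob_space_iid)
  interpret Q: prob_space "iid (trit_pmf q)" by (rule prob_space_iid)
  let ?A = "\<lambda>L. {x. 1 / 2 ^ k < hit_prob f (2 * k) L x}"
  have "emeasure (iid (trit_pmf p)) (?A L) \<le> ennreal (1 / 2 ^ k)" for L
  proof -
    have "ennreal (1 / 2 ^ k) * emeasure (iid (trit_pmf p)) (?A L) =
        (\<integral>\<^sup>+x. ennreal (1 / 2 ^ k) * indicator (?A L) x \<partial>iid (trit_pmf p))"
      by (rule nn_integral_cmult_indicator[OF sets_heavy_level, symmetric])
    also have "\<dots> \<le> (\<integral>\<^sup>+x. ennreal (hit_prob f (2 * k) L x) \<partial>iid (trit_pmf p))"
    proof (rule nn_integral_mono)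
      show "ennreal (1 / 2 ^ k) * indicator (?A L) x \<le> ennreal (hit_prob f (2 * k) L x)" for x
        by (cases "x \<in> ?A L") (simp_all add: ennreal_leI)
    qed
    also have "\<dots> \<le> emeasure (iid (trit_pmf q)) (coded_open (range f) (2 * k))"
      by (rule nn_integral_hit_prob)
    also have "\<dots> \<le> ennreal (1 / 2 ^ (2 * k))"
      unfolding Q.emeasure_eq_measure using assms
      by (intro ennreal_leI) (simp only: bernoulli_measure_def)
    finally have "ennreal (1 / 2 ^ k * measure (iid (trit_pmf p)) (?A L)) \<le> ennreal (1 / 2 ^ (2 * k))"
      by (simp only: P.emeasure_eq_measure ennreal_mult measure_nonneg zero_le_divide_1_iff
          zero_le_power zero_le_numeral)
    then have "1 / 2 ^ k * measure (iid (trit_pmf p)) (?A L) \<le> 1 / 2 ^ k * (1 / 2 ^ k)"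
      by (simp add: mult_2 power_add)
    then have "measure (iid (trit_pmf p)) (?A L) \<le> 1 / 2 ^ k"
      by (rule mult_left_le_imp_le) simp
    then show ?thesis
      unfolding P.emeasure_eq_measure by (rule ennreal_leI)
  qed
  moreover have "incseq ?A"
    using hit_prob_mono by (intro monoI) (auto intro: less_le_trans)
  ultimately have "emeasure (iid (trit_pmf p)) (heavy f k) \<le> ennreal (1 / 2 ^ k)"
    unfolding heavy_eq using sets_heavy_level
    by (subst SUP_emeasure_incseq[symmetric]) (auto intro!: SUP_least)
  then show ?thesis by (simp add: P.emeasure_eq_measure)
qed

text \<open>Avoiding one set \<open>heavy_tail f m\<close> means avoiding all but finitely many of the sets
  \<open>heavy f k\<close>.\<close>

definition heavy_tail :: "(nat \<Rightarrow> nat) \<Rightarrow> nat \<Rightarrow> (nat \<Rightarrow> trit) set" where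
  "heavy_tail f m = (\<Union>k\<in>{m<..}. heavy f k)"

lemma measure_heavy_tail:
  assumes "\<And>m. measure (bernoulli_measure q) (coded_open (range f) m) \<le> 1 / 2 ^ m"
  shows "measure (bernoulli_measure p) (heavy_tail f m) \<le> 1 / 2 ^ m"
proof -
  interpret P: prob_space "iid (trit_pmf p)" by (rule prob_space_iid)
  have "{m<..} = range (\<lambda>j. Suc m + j)"
    by (auto simp: less_iff_Suc_add image_iff)
  then have eq: "heavy_tail f m = (\<Union>j. heavy f (Suc m + j))"
    unfolding heavy_tail_def by simp
  \<comment> \<open>Starting the tail at \<open>m + 1\<close> makes the geometric series add up to
    exactly \<open>1 / 2 ^ m\<close>.\<close>
  have sums: "(\<lambda>j. 1 / 2 ^ (Suc m + j)) sums (1 / 2 ^ m :: real)"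
    using sums_mult[OF geometric_sums[of "1 / 2 :: real"], of "1 / 2 ^ Suc m"]
    by (simp add: power_add power_divide mult.assoc)
  have le: "measure (iid (trit_pmf p)) (heavy f k) \<le> 1 / 2 ^ k" for k
    by (rule measure_heavy[OF assms])
  have summ: "summable (\<lambda>j. measure (iid (trit_pmf p)) (heavy f (Suc m + j)))"
  proof (rule summable_comparison_test'[OF sums_summable[OF sums]])
    show "norm (measure (iid (trit_pmf p)) (heavy f (Suc m + j))) \<le> 1 / 2 ^ (Suc m + j)" for j
      using le[of "Suc m + j"] by (simp only: real_norm_def abs_of_nonneg measure_nonneg)
  qed
  have "measure (iid (trit_pmf p)) (heavy_tail f m) \<le> (\<Sum>j. measure (iid (trit_pmf p)) (heavy f (Suc m + j)))"
    unfolding eq by (rule P.finite_measure_subadditive_countably) (use sets_heavy summ in auto)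
  also have "\<dots> \<le> (\<Sum>j. 1 / 2 ^ (Suc m + j))"
    by (rule suminf_le[OF le summ sums_summable[OF sums]])
  also have "\<dots> = 1 / 2 ^ m" using sums by (rule sums_unique[symmetric])
  finally show ?thesis by (simp add: bernoulli_measure_def)
qed

end

section \<open>Effective lower approximation of the hit probabilities\<close>

lemma lower_approx_seq:
  assumes "0 < \<alpha>"
  obtains c :: "nat \<Rightarrow> nat" where "\<And>d. 0 < d \<Longrightarrow> real (c d) / real d < \<alpha>"
    "(\<lambda>d. real (c d) / real d) \<longlonglongrightarrow> \<alpha>"
proof
  \<comment> \<open>The largest numerator whose fraction stays strictly below the limit; rounding
    down would allow equality.\<close>
  define c where "c d = nat (\<lceil>\<alpha> * real d\<rceil> - 1)" for d
  have c: "real (c d) = real_of_int \<lceil>\<alpha> * real d\<rceil> - 1" if "0 < d" for d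
  proof -
    have "0 < \<alpha> * real d" using that assms by simp
    then have "1 \<le> \<lceil>\<alpha> * real d\<rceil>" by linarith
    then show ?thesis by (simp add: c_def)
  qed
  show less: "real (c d) / real d < \<alpha>" if d: "0 < d" for d
  proof -
    have "real (c d) < \<alpha> * real d" unfolding c[OF d] by linarith
    then show ?thesis using d by (simp add: pos_divide_less_eq)
  qed
  have ge: "\<alpha> - 1 / real d \<le> real (c d) / real d" if d: "0 < d" for d
  proof -
    have "\<alpha> * real d - 1 \<le> real (c d)" unfolding c[OF d] by linarith
    moreover have "\<alpha> - 1 / real d = (\<alpha> * real d - 1) / real d"
      using d by (simp add: field_simps)
    ultimately show ?thesis by (simp add: divide_right_mono)
  qed
  have "(\<lambda>d. \<alpha> - 1 / real d) \<longlonglongrightarrow> \<alpha>" by real_asymp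
  moreover have "eventually (\<lambda>d. \<alpha> - 1 / real d \<le> real (c d) / real d) sequentially"
    by (rule eventually_mono[OF eventually_gt_at_top[of 0]]) (rule ge)
  moreover have "eventually (\<lambda>d. real (c d) / real d \<le> \<alpha>) sequentially"
    by (rule eventually_mono[OF eventually_gt_at_top[of 0]]) (rule less_imp_le[OF less])
  ultimately show "(\<lambda>d. real (c d) / real d) \<longlonglongrightarrow> \<alpha>"
    by (rule tendsto_sandwich[rotated 2, OF _ tendsto_const])
qed

lemma real_nat_weight:
  assumes "0 < d"
  shows "real (weight (nat_kernel d c3 c4) (nat_marginal c1 c2) L w x y) = real d ^ L *
    weight (\<lambda>a c. real (nat_kernel d c3 c4 a c) / real d) (\<lambda>c. real (nat_marginal c1 c2 c) / real d) L w x y"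
proof -
  have "real (weight (nat_kernel d c3 c4) (nat_marginal c1 c2) L w x y) =
      (\<Prod>j<L. real d * (case run w x y j of (v, r) \<Rightarrow> if hd v
        then real (nat_kernel d c3 c4 (x r) (y j)) / real d else real (nat_marginal c1 c2 (y j)) / real d))"
    unfolding weight_eq_prod of_nat_prod using assms
    by (intro prod.cong refl) (auto split: prod.split)
  then show ?thesis
    unfolding weight_eq_prod prod.distrib by simp
qed

lemma weight_mono:
  fixes K K' :: "trit \<Rightarrow> trit \<Rightarrow> real"
  assumes "\<And>a c. 0 \<le> K a c" "\<And>a c. K a c \<le> K' a c" "\<And>c. 0 \<le> q c" "\<And>c. q c \<le> q' c"
  shows "weight K q L w x y \<le> weight K' q' L w x y"
  unfolding weight_eq_prod using assms by (intro prod_mono) (auto split: prod.split)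

lemma tendsto_weight:
  fixes K :: "trit \<Rightarrow> trit \<Rightarrow> real"
  assumes "\<And>a c. (\<lambda>d. K' d a c) \<longlonglongrightarrow> K a c" "\<And>c. (\<lambda>d. q' d c) \<longlonglongrightarrow> q c"
  shows "(\<lambda>d. weight (K' d) (q' d) L w x y) \<longlonglongrightarrow> weight K q L w x y"
proof -
  have "(\<lambda>d. case run w x y j of (v, r) \<Rightarrow> if hd v then K' d (x r) (y j) else q' d (y j))
    \<longlonglongrightarrow> (case run w x y j of (v, r) \<Rightarrow> if hd v then K (x r) (y j) else q (y j))" for j
    using assms by (cases "run w x y j") simp
  then show ?thesis
    unfolding weight_eq_prod by (rule tendsto_prod)
qed

definition nat_hit_prob :: "(nat \<Rightarrow> nat) \<Rightarrow> nat \<Rightarrow> nat \<Rightarrow> nat \<Rightarrow> nat \<Rightarrow> nat \<Rightarrow> nat \<Rightarrow> nat \<Rightarrow>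
    (nat \<Rightarrow> trit) \<Rightarrow> nat" where
  "nat_hit_prob f m L d c1 c2 c3 c4 x = (\<Sum>e<3 ^ L. of_bool (hits f m L (digits e)) *
     weight (nat_kernel d c3 c4) (nat_marginal c1 c2) L [True] x (digits e))"

lemma nat_hit_prob_eq: "nat_hit_prob f m L d c1 c2 c3 c4 x = (\<Sum>e\<in>hit_codes f m L.
    weight (nat_kernel d c3 c4) (nat_marginal c1 c2) L [True] x (digits e))"
  unfolding nat_hit_prob_def hit_codes_def
  by (intro sum.mono_neutral_cong_right) auto

text \<open>The hit probability is a sum of products of four positive factors, hence monotone and
  continuous in them. It exceeds a threshold iff it does so already with fractions strictly below
  the factors, and a common denominator \<open>d\<close> is cleared by multiplying with
  \<open>d ^ L\<close>.\<close>

lemma (in root_split) hit_prob_gt_iff: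
  "1 / 2 ^ k < hit_prob f m L x \<longleftrightarrow> (\<exists>d c1 c2 c3 c4. 0 < d \<and>
     real c1 / real d < q \<and> real c2 / real d < 1 - 2 * q \<and>
     real c3 / real d < q / p \<and> real c4 / real d < 1 - q / p \<and>
     d ^ L < 2 ^ k * nat_hit_prob f m L d c1 c2 c3 c4 x)"
proof -
  define S where "S d c1 c2 c3 c4 = (\<Sum>e\<in>hit_codes f m L.
    weight (\<lambda>a c. real (nat_kernel d c3 c4 a c) / real d) (\<lambda>c. real (nat_marginal c1 c2 c) / real d)
      L [True] x (digits e))" for d c1 c2 c3 c4
  have nat: "d ^ L < 2 ^ k * nat_hit_prob f m L d c1 c2 c3 c4 x \<longleftrightarrow> 1 / 2 ^ k < S d c1 c2 c3 c4"
    if d: "0 < d" for d c1 c2 c3 c4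
  proof -
    have "real (2 ^ k * nat_hit_prob f m L d c1 c2 c3 c4 x) = 2 ^ k * (real d ^ L * S d c1 c2 c3 c4)"
      unfolding nat_hit_prob_eq S_def of_nat_mult of_nat_power of_nat_sum real_nat_weight[OF d]
        sum_distrib_left[symmetric] of_nat_numeral ..
    then have "d ^ L < 2 ^ k * nat_hit_prob f m L d c1 c2 c3 c4 x \<longleftrightarrow>
        real d ^ L * 1 < real d ^ L * (2 ^ k * S d c1 c2 c3 c4)"
      unfolding of_nat_less_iff[where 'a = real, symmetric] of_nat_power
      by (simp only: mult_1_right mult.left_commute)
    also have "\<dots> \<longleftrightarrow> 1 < 2 ^ k * S d c1 c2 c3 c4"
      using d by (subst mult_less_cancel_left_pos) auto
    finally show ?thesis by (simp add: field_simps)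
  qed
  have q: "pmf (trit_pmf q) c = (if c = T2 then 1 - 2 * q else q)" for c
    using q_pos q_half by (cases c) (simp_all add: pmf_trit_pmf)
  show ?thesis
  proof
    assume gt: "1 / 2 ^ k < hit_prob f m L x"
    have 2: "0 < 1 - 2 * q" using q_less_p p_half by simp
    have 4: "0 < 1 - q / p" using ratio_less_1 by simp
    obtain c1 where c1: "\<And>d. 0 < d \<Longrightarrow> real (c1 d) / real d < q" "(\<lambda>d. real (c1 d) / real d) \<longlonglongrightarrow> q"
      using lower_approx_seq[OF q_pos] by metis
    obtain c2 where c2: "\<And>d. 0 < d \<Longrightarrow> real (c2 d) / real d < 1 - 2 * q" "(\<lambda>d. real (c2 d) / real d) \<longlonglongrightarrow> 1 - 2 * q"
      using lower_approx_seq[OF 2] by metis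
    obtain c3 where c3: "\<And>d. 0 < d \<Longrightarrow> real (c3 d) / real d < q / p" "(\<lambda>d. real (c3 d) / real d) \<longlonglongrightarrow> q / p"
      using lower_approx_seq[OF ratio_pos] by metis
    obtain c4 where c4: "\<And>d. 0 < d \<Longrightarrow> real (c4 d) / real d < 1 - q / p" "(\<lambda>d. real (c4 d) / real d) \<longlonglongrightarrow> 1 - q / p"
      using lower_approx_seq[OF 4] by metis
    \<comment> \<open>The probability 1 of passing from \<open>T2\<close> to \<open>T2\<close> is
      represented by \<open>d / d\<close>, which differs from 1 only at
      \<open>d = 0\<close>.\<close>
    have one: "(\<lambda>d. real d / real d) \<longlonglongrightarrow> 1"
      by (rule tendsto_eventually) (use eventually_gt_at_top[of "0::nat"] in eventually_elim, simp)
    have "(\<lambda>d. real (nat_kernel d (c3 d) (c4 d) a c) / real d) \<longlonglongrightarrow> kernel (q / p) a c" for a c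
      using c3(2) c4(2) one by (cases a; cases c) (simp_all add: nat_kernel_def kernel_def)
    moreover have "(\<lambda>d. real (nat_marginal (c1 d) (c2 d) c) / real d) \<longlonglongrightarrow> pmf (trit_pmf q) c" for c
      using c1(2) c2(2) unfolding q by (cases c) (simp_all add: nat_marginal_def)
    ultimately have "(\<lambda>d. S d (c1 d) (c2 d) (c3 d) (c4 d)) \<longlonglongrightarrow> hit_prob f m L x"
      unfolding S_def hit_prob_def by (intro tendsto_sum tendsto_weight)
    from order_tendstoD(1)[OF this gt] eventually_gt_at_top[of "0::nat"]
    have "eventually (\<lambda>d. 0 < d \<and> 1 / 2 ^ k < S d (c1 d) (c2 d) (c3 d) (c4 d)) sequentially"
      by eventually_elim simp
    then obtain d where d: "0 < d" "1 / 2 ^ k < S d (c1 d) (c2 d) (c3 d) (c4 d)"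
      using eventually_happens'[OF sequentially_bot] by blast
    show "\<exists>d c1 c2 c3 c4. 0 < d \<and>
     real c1 / real d < q \<and> real c2 / real d < 1 - 2 * q \<and>
     real c3 / real d < q / p \<and> real c4 / real d < 1 - q / p \<and>
     d ^ L < 2 ^ k * nat_hit_prob f m L d c1 c2 c3 c4 x"
      by (rule exI[of _ d], rule exI[of _ "c1 d"], rule exI[of _ "c2 d"], rule exI[of _ "c3 d"],
          rule exI[of _ "c4 d"]) (use d nat c1(1) c2(1) c3(1) c4(1) in simp)
  next
    assume "\<exists>d c1 c2 c3 c4. 0 < d \<and>
     real c1 / real d < q \<and> real c2 / real d < 1 - 2 * q \<and>
     real c3 / real d < q / p \<and> real c4 / real d < 1 - q / p \<and>
     d ^ L < 2 ^ k * nat_hit_prob f m L d c1 c2 c3 c4 x"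
    then obtain d c1 c2 c3 c4 where d: "0 < d" and c: "real c1 / real d < q"
      "real c2 / real d < 1 - 2 * q" "real c3 / real d < q / p" "real c4 / real d < 1 - q / p"
      and "d ^ L < 2 ^ k * nat_hit_prob f m L d c1 c2 c3 c4 x"
      by blast
    then have gt: "1 / 2 ^ k < S d c1 c2 c3 c4"
      by (simp only: nat)
    have "real (nat_kernel d c3 c4 a b) / real d \<le> kernel (q / p) a b" for a b
      using c(3,4) d by (cases a; cases b) (simp_all add: nat_kernel_def kernel_def)
    moreover have "real (nat_marginal c1 c2 b) / real d \<le> pmf (trit_pmf q) b" for b
      using c(1,2) unfolding q by (simp add: nat_marginal_def)
    ultimately have "S d c1 c2 c3 c4 \<le> hit_prob f m L x"
      unfolding S_def hit_prob_def by (intro sum_mono weight_mono) auto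
    with gt show "1 / 2 ^ k < hit_prob f m L x" by simp
  qed
qed

lemma decidable_hits:
  assumes f: "computable_in g f" and m: "computable_in g m" and L: "computable_in g L"
    and e: "computable_in g e"
  shows "decidable_in g (\<lambda>v. hits f (m v) (L v) (digits (e v)))"
  unfolding hits_def
  by (intro computable_intros computable_prefix_code assms assms[THEN computable_in.comp])

lemma computable_nat_hit_prob:
  assumes "computable_in g f" "computable_in g m" "computable_in g L" "computable_in g d"
    "computable_in g c1" "computable_in g c2" "computable_in g c3" "computable_in g c4"
    "computable_in g ex"
  shows "computable_in g (\<lambda>v. nat_hit_prob f (m v) (L v) (d v) (c1 v) (c2 v) (c3 v) (c4 v) (digits (ex v)))"
  unfolding nat_hit_prob_def
  by (intro computable_intros decidable_hits computable_weight assms assms[THEN computable_in.comp])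

lemma lower_ceE:
  assumes "lower_ce \<alpha>"
  obtains R where "\<And>g c d i. computable_in g c \<Longrightarrow> computable_in g d \<Longrightarrow> computable_in g i \<Longrightarrow>
      decidable_in g (\<lambda>v. R (c v) (d v) (i v))"
    "\<And>c d. 0 < d \<Longrightarrow> real c / real d < \<alpha> \<longleftrightarrow> (\<exists>i. R c d i)"
proof -
  obtain R where R: "decidable_in (\<lambda>_. 0) (\<lambda>v. R (pfst v) (pfst (psnd v)) (psnd (psnd v)))"
    "\<And>c d. 0 < d \<Longrightarrow> real c / real d < \<alpha> \<longleftrightarrow> (\<exists>i. R c d i)"
    using assms unfolding lower_ce_def by blast
  have "decidable_in g (\<lambda>v. R (c v) (d v) (i v))"
    if "computable_in g c" "computable_in g d" "computable_in g i" for g c d i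
    using computable_in.comp[OF computable_in_mono[OF R(1)] pair[OF that(1) pair[OF that(2,3)]]]
    by simp
  with R(2) show ?thesis by (rule that[rotated])
qed

lemma (in root_split) hit_prob_cong:
  "(\<And>i. i < L \<Longrightarrow> x i = y i) \<Longrightarrow> hit_prob f m L x = hit_prob f m L y"
  unfolding hit_prob_def by (intro sum.cong refl weight_cong) auto

text \<open>A prefix is enumerated together with a certificate: an index \<open>k\<close> beyond
  \<open>m\<close>, four fractions and a witness that each is below its factor. The whole
  certificate is coded in one number, and checking it is decidable relative to
  \<open>g\<close>.\<close>

lemma (in root_split) ce_heavy_tail:
  assumes f: "computable_in g f"
  shows "\<exists>W. ce_in g W \<and> heavy_tail f = coded_open W"
proof -
  obtain R1 where R1: "\<And>g c d i. computable_in g c \<Longrightarrow> computable_in g d \<Longrightarrow> computable_in g i \<Longrightarrow>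
      decidable_in g (\<lambda>v. R1 (c v) (d v) (i v))"
    "\<And>c d. 0 < d \<Longrightarrow> real c / real d < q \<longleftrightarrow> (\<exists>i. R1 c d i)"
    by (rule lower_ceE[OF lower_ce_factors(1)]) (rule that)
  obtain R2 where R2: "\<And>g c d i. computable_in g c \<Longrightarrow> computable_in g d \<Longrightarrow> computable_in g i \<Longrightarrow>
      decidable_in g (\<lambda>v. R2 (c v) (d v) (i v))"
    "\<And>c d. 0 < d \<Longrightarrow> real c / real d < 1 - 2 * q \<longleftrightarrow> (\<exists>i. R2 c d i)"
    by (rule lower_ceE[OF lower_ce_factors(2)]) (rule that)
  obtain R3 where R3: "\<And>g c d i. computable_in g c \<Longrightarrow> computable_in g d \<Longrightarrow> computable_in g i \<Longrightarrow>
      decidable_in g (\<lambda>v. R3 (c v) (d v) (i v))"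
    "\<And>c d. 0 < d \<Longrightarrow> real c / real d < q / p \<longleftrightarrow> (\<exists>i. R3 c d i)"
    by (rule lower_ceE[OF lower_ce_factors(3)]) (rule that)
  obtain R4 where R4: "\<And>g c d i. computable_in g c \<Longrightarrow> computable_in g d \<Longrightarrow> computable_in g i \<Longrightarrow>
      decidable_in g (\<lambda>v. R4 (c v) (d v) (i v))"
    "\<And>c d. 0 < d \<Longrightarrow> real c / real d < 1 - q / p \<longleftrightarrow> (\<exists>i. R4 c d i)"
    by (rule lower_ceE[OF lower_ce_factors(4)]) (rule that)
  define P where "P L k e d c1 c2 c3 c4 i1 i2 i3 i4 \<longleftrightarrow> 0 < d \<and> R1 c1 d i1 \<and> R2 c2 d i2 \<and>
    R3 c3 d i3 \<and> R4 c4 d i4 \<and> d ^ L < 2 ^ k * nat_hit_prob f (2 * k) L d c1 c2 c3 c4 (digits e)"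
    for L k e d c1 c2 c3 c4 i1 i2 i3 i4
  have P: "1 / 2 ^ k < hit_prob f (2 * k) L (digits e) \<longleftrightarrow>
      (\<exists>d c1 c2 c3 c4 i1 i2 i3 i4. P L k e d c1 c2 c3 c4 i1 i2 i3 i4)" for k L e
  proof -
    have "0 < d \<and> real c1 / real d < q \<and> real c2 / real d < 1 - 2 * q \<and>
       real c3 / real d < q / p \<and> real c4 / real d < 1 - q / p \<and>
       d ^ L < 2 ^ k * nat_hit_prob f (2 * k) L d c1 c2 c3 c4 (digits e) \<longleftrightarrow>
       (\<exists>i1 i2 i3 i4. P L k e d c1 c2 c3 c4 i1 i2 i3 i4)" for d c1 c2 c3 c4
    proof (cases "0 < d")
      case True
      show ?thesis
        unfolding P_def R1(2)[OF True] R2(2)[OF True] R3(2)[OF True] R4(2)[OF True] by simp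
    qed (simp add: P_def)
    then show ?thesis
      by (simp only: hit_prob_gt_iff)
  qed
  \<comment> \<open>Entry \<open>j\<close> of a right-nested tuple of numbers, closed by a final
    0.\<close>
  let ?t = "\<lambda>j v. pfst ((psnd ^^ j) v)"
  define t where "t j v = ?t j v" for j v
  have t: "computable_in g (t j)" for j
  proof -
    have "computable_in g (psnd ^^ j)"
      by (induction j) (simp_all add: computable_id comp_def computable_psnd id_def)
    then show ?thesis unfolding t_def by (intro computable_pfst) simp
  qed
  have ex_t: "\<exists>v. t 0 v = m \<and> t 1 v = L \<and> t 2 v = k \<and> t 3 v = e \<and> t 4 v = d \<and> t 5 v = c1 \<and>
    t 6 v = c2 \<and> t 7 v = c3 \<and> t 8 v = c4 \<and> t 9 v = i1 \<and> t 10 v = i2 \<and> t 11 v = i3 \<and> t 12 v = i4"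
    for m L k e d c1 c2 c3 c4 i1 i2 i3 i4
    unfolding t_def
    by (rule exI[of _ "prod_encode (m, prod_encode (L, prod_encode (k, prod_encode (e,
      prod_encode (d, prod_encode (c1, prod_encode (c2, prod_encode (c3, prod_encode (c4,
      prod_encode (i1, prod_encode (i2, prod_encode (i3, prod_encode (i4, 0)))))))))))))"])
      (simp add: numeral_eq_Suc)
  \<comment> \<open>Entries 0 to 3 are the test index, the prefix length, the certificate index
    \<open>k\<close> and the code of the prefix. The prefix length is also the stage, since the hit
    probability at stage \<open>L\<close> depends on \<open>L\<close> symbols.\<close>
  define W where "W = {prod_encode (t 0 v, prefix_code (digits (t 3 v)) (t 1 v)) |v. t 0 v < t 2 v \<and>
    P (t 1 v) (t 2 v) (t 3 v) (t 4 v) (t 5 v) (t 6 v) (t 7 v) (t 8 v) (t 9 v) (t 10 v) (t 11 v) (t 12 v)}"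
  have "ce_in g W"
    unfolding W_def
  proof (rule ce_in_image)
    show "computable_in g (\<lambda>v. prod_encode (t 0 v, prefix_code (digits (t 3 v)) (t 1 v)))"
      by (intro computable_intros computable_prefix_code t)
    show "decidable_in g (\<lambda>v. t 0 v < t 2 v \<and>
      P (t 1 v) (t 2 v) (t 3 v) (t 4 v) (t 5 v) (t 6 v) (t 7 v) (t 8 v) (t 9 v) (t 10 v) (t 11 v) (t 12 v))"
      unfolding P_def
      by (intro computable_intros R1(1) R2(1) R3(1) R4(1) computable_nat_hit_prob t f)
  qed
  moreover have "x \<in> heavy_tail f m \<longleftrightarrow> x \<in> coded_open W m" for x m
  proof -
    have W_iff: "prod_encode (m, s) \<in> W \<longleftrightarrow> (\<exists>L k e. s = prefix_code (digits e) L \<and> m < k \<and>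
        1 / 2 ^ k < hit_prob f (2 * k) L (digits e))" for s
    proof
      assume "prod_encode (m, s) \<in> W"
      then show "\<exists>L k e. s = prefix_code (digits e) L \<and> m < k \<and>
        1 / 2 ^ k < hit_prob f (2 * k) L (digits e)"
        unfolding W_def P by (clarsimp simp: prod_encode_eq) blast
    next
      assume "\<exists>L k e. s = prefix_code (digits e) L \<and> m < k \<and>
        1 / 2 ^ k < hit_prob f (2 * k) L (digits e)"
      then obtain L k e d c1 c2 c3 c4 i1 i2 i3 i4 where
        *: "s = prefix_code (digits e) L" "m < k" "P L k e d c1 c2 c3 c4 i1 i2 i3 i4"
        unfolding P by blast
      obtain v where "t 0 v = m \<and> t 1 v = L \<and> t 2 v = k \<and> t 3 v = e \<and> t 4 v = d \<and> t 5 v = c1 \<and>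
        t 6 v = c2 \<and> t 7 v = c3 \<and> t 8 v = c4 \<and> t 9 v = i1 \<and> t 10 v = i2 \<and> t 11 v = i3 \<and> t 12 v = i4"
        using ex_t by blast
      with * show "prod_encode (m, s) \<in> W"
        unfolding W_def mem_Collect_eq by (intro exI[of _ v]) simp
    qed
    have "x \<in> heavy_tail f m \<longleftrightarrow> (\<exists>k L. m < k \<and> 1 / 2 ^ k < hit_prob f (2 * k) L x)"
      unfolding heavy_tail_def heavy_def by auto
    also have "\<dots> \<longleftrightarrow> (\<exists>K L k e. prefix_code x K = prefix_code (digits e) L \<and> m < k \<and>
        1 / 2 ^ k < hit_prob f (2 * k) L (digits e))"
    proof
      assume "\<exists>k L. m < k \<and> 1 / 2 ^ k < hit_prob f (2 * k) L x"
      then obtain k L where kL: "m < k" "1 / 2 ^ k < hit_prob f (2 * k) L x" by blast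
      obtain e where "\<forall>i<L. digits e i = x i"
        using digits_exist by blast
      then have "prefix_code x L = prefix_code (digits e) L"
        "hit_prob f (2 * k) L (digits e) = hit_prob f (2 * k) L x"
        by (auto intro!: prefix_code_cong hit_prob_cong)
      with kL show "\<exists>K L k e. prefix_code x K = prefix_code (digits e) L \<and> m < k \<and>
          1 / 2 ^ k < hit_prob f (2 * k) L (digits e)"
        by metis
    next
      assume "\<exists>K L k e. prefix_code x K = prefix_code (digits e) L \<and> m < k \<and>
          1 / 2 ^ k < hit_prob f (2 * k) L (digits e)"
      then obtain K L k e where "prefix_code x K = prefix_code (digits e) L"
        and k: "m < k" "1 / 2 ^ k < hit_prob f (2 * k) L (digits e)" by blast
      then have "\<forall>i<L. x i = digits e i"
        by (auto simp: prefix_code_eq_iff)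
      then have "hit_prob f (2 * k) L (digits e) = hit_prob f (2 * k) L x"
        by (intro hit_prob_cong) auto
      with k show "\<exists>k L. m < k \<and> 1 / 2 ^ k < hit_prob f (2 * k) L x" by metis
    qed
    also have "\<dots> \<longleftrightarrow> x \<in> coded_open W m"
      unfolding coded_open_iff W_iff by blast
    finally show ?thesis .
  qed
  then have "heavy_tail f = coded_open W" by blast
  ultimately show ?thesis by blast
qed

section \<open>Randomness of the constructed codes\<close>

context root_split
begin

lemma hit_prob_le_of_random:
  assumes f: "computable_in (\<lambda>i. trit_code (z i)) f"
    and test: "\<And>m. measure (bernoulli_measure q) (coded_open (range f) m) \<le> 1 / 2 ^ m"
    and x: "martin_loef_random p z x"
  shows "\<exists>m. \<forall>k>m. \<forall>L. hit_prob f (2 * k) L x \<le> 1 / 2 ^ k"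
proof -
  obtain W where "ce_in (\<lambda>i. trit_code (z i)) W" "heavy_tail f = coded_open W"
    using ce_heavy_tail[OF f] by blast
  with measure_heavy_tail[OF test] have "martin_loef_test p z (heavy_tail f)"
    unfolding martin_loef_test_def by blast
  with x have "x \<notin> (\<Inter>m. heavy_tail f m)"
    unfolding martin_loef_random_def by blast
  then show ?thesis
    unfolding heavy_tail_def heavy_def by (auto simp: not_less)
qed

text \<open>For one test, randomness of \<open>x\<close> bounds the conditional probability of its
  set of index \<open>2 * k\<close> by \<open>1 / 2 ^ k\<close> for all large \<open>k\<close>, so
  the intersection has conditional probability 0; countably many null events are then discarded
  together.\<close>

lemma AE_emit_random:
  assumes D: "measure_pmf.prob D {v. h v} = q / p"
    and x: "martin_loef_random p z x"
  shows "AE \<omega> in iid D \<Otimes>\<^sub>M iid (trit_pmf q).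
    martin_loef_random q z (\<lambda>j. emit j [True] x (\<lambda>i. h (fst \<omega> i)) (snd \<omega>))"
proof -
  let ?M = "iid D \<Otimes>\<^sub>M iid (trit_pmf q)"
  let ?g = "\<lambda>i. trit_code (z i)"
  define y where "y \<omega> = (\<lambda>j. emit j [True] x (\<lambda>i. h (fst \<omega> i)) (snd \<omega>))" for \<omega>
  note hits = hits_emit[OF D, of _ _ _ x, folded y_def]
  define \<W> where "\<W> = {W. ce_in ?g W \<and> (\<forall>m. measure (bernoulli_measure q) (coded_open W m) \<le> 1 / 2 ^ m)}"
  have "AE \<omega> in ?M. y \<omega> \<notin> (\<Inter>m. coded_open W m)" if W: "W \<in> \<W>" for W
  proof (cases "W = {}")
    case True
    then show ?thesis by (simp add: coded_open_def)
  next
    case False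
    with W obtain f where f: "computable_in ?g f" "W = range f"
      and test: "\<And>m. measure (bernoulli_measure q) (coded_open (range f) m) \<le> 1 / 2 ^ m"
      unfolding \<W>_def ce_in_def by blast
    obtain m where m: "\<And>k L. m < k \<Longrightarrow> hit_prob f (2 * k) L x \<le> 1 / 2 ^ k"
      using hit_prob_le_of_random[OF f(1) test x] by blast
    \<comment> \<open>The event that \<open>y\<close> enters the test set of index
      \<open>2 * k\<close>. Even indices suffice, since the intersection of all test sets lies in
      each of these.\<close>
    define B where "B k = (\<Union>L. {\<omega>. hits f (2 * k) L (y \<omega>)})" for k
    have B_sets: "B k \<in> sets ?M" for k
      unfolding B_def by (intro sets.countable_UN image_subsetI hits(1))
    have B_le: "emeasure ?M (B k) \<le> ennreal (1 / 2 ^ k)" if "m < k" for k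
    proof -
      have "incseq (\<lambda>L. {\<omega>. hits f (2 * k) L (y \<omega>)})"
        by (rule monoI) (use hits_mono in blast)
      then have "emeasure ?M (B k) = (SUP L. emeasure ?M {\<omega>. hits f (2 * k) L (y \<omega>)})"
        unfolding B_def
        by (rule SUP_emeasure_incseq[symmetric, rotated]) (intro image_subsetI hits(1))
      also have "\<dots> \<le> ennreal (1 / 2 ^ k)"
        unfolding hits(2) by (intro SUP_least ennreal_leI m that)
      finally show ?thesis .
    qed
    have "emeasure ?M (\<Inter>k. B (Suc m + k)) \<le> ennreal (1 / 2 ^ (Suc m + k))" for k
    proof -
      have "(\<Inter>k. B (Suc m + k)) \<subseteq> B (Suc m + k)" by blast
      from emeasure_mono[OF this B_sets] B_le[of "Suc m + k"] show ?thesis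
        by (auto intro: order_trans)
    qed
    moreover have "(\<lambda>k. ennreal (1 / 2 ^ (Suc m + k))) \<longlonglongrightarrow> ennreal 0"
      by (intro tendsto_ennrealI) real_asymp
    ultimately have "emeasure ?M (\<Inter>k. B (Suc m + k)) \<le> ennreal 0"
      by (intro LIMSEQ_le_const[of _ "ennreal 0"]) blast+
    then have null: "emeasure ?M (\<Inter>k. B (Suc m + k)) = 0" by simp
    show ?thesis
    proof (rule AE_I[OF _ null])
      show "{\<omega> \<in> space ?M. \<not> y \<omega> \<notin> (\<Inter>m. coded_open W m)} \<subseteq> (\<Inter>k. B (Suc m + k))"
        unfolding f(2) B_def by (auto simp: coded_open_hits simp del: add_Suc)
      show "(\<Inter>k. B (Suc m + k)) \<in> sets ?M"
        by (intro sets.countable_INT image_subsetI B_sets) simp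
    qed
  qed
  moreover have "countable \<W>"
    by (rule countable_subset[OF _ countable_ce[of ?g]]) (auto simp: \<W>_def)
  ultimately have "AE \<omega> in ?M. \<forall>W\<in>\<W>. y \<omega> \<notin> (\<Inter>m. coded_open W m)"
    by (rule AE_ball_countable')
  then have "AE \<omega> in ?M. martin_loef_random q z (y \<omega>)"
  proof (rule AE_mp, intro AE_I2 impI)
    fix \<omega> assume "\<forall>W\<in>\<W>. y \<omega> \<notin> (\<Inter>m. coded_open W m)"
    then show "martin_loef_random q z (y \<omega>)"
      unfolding martin_loef_random_def martin_loef_test_def \<W>_def by blast
  qed
  then show ?thesis unfolding y_def .
qed

text \<open>With probability \<open>\<beta>\<close> all codes but a uniformly chosen one widen,
  otherwise none does. A given code then widens with probability
  \<open>\<beta> * (n - 1) / n\<close>, and equating this with \<open>1 - q / p\<close> yields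
  \<open>\<beta>\<close>; the condition \<open>\<beta> \<le> 1\<close> amounts to
  \<open>p_le\<close>.\<close>

lemma coupling:
  obtains D :: "(bool \<times> nat) pmf" and h :: "nat \<Rightarrow> bool \<times> nat \<Rightarrow> bool"
  where "\<And>i. i \<in> {1..n} \<Longrightarrow> measure_pmf.prob D {v. h i v} = q / p" "\<And>v. \<exists>i\<in>{1..n}. h i v"
proof -
  define \<beta> where "\<beta> = (1 - q / p) * real n / (real n - 1)"
  have n1: "0 < real n - 1" using n by simp
  have "1 \<le> real n * (q / p)"
    using p_le p_pos by (simp add: field_simps)
  then have "(1 - q / p) * real n \<le> real n - 1"
    unfolding left_diff_distrib mult_1_left by (simp only: mult.commute[of _ "real n"] diff_left_mono)
  moreover have "0 \<le> 1 - q / p"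
    using ratio_less_1 by simp
  ultimately have \<beta>: "0 \<le> \<beta>" "\<beta> \<le> 1"
    using n1 unfolding \<beta>_def
    by (auto simp only: pos_divide_le_eq mult_1_left intro!: divide_nonneg_nonneg mult_nonneg_nonneg)
  define D where "D = pair_pmf (bernoulli_pmf \<beta>) (pmf_of_set {1..n})"
  \<comment> \<open>Membership in \<open>{1..n}\<close> is part of the event so that some code
    repeats for every \<open>v\<close>, even outside the support of \<open>D\<close>.\<close>
  define h where "h i v \<longleftrightarrow> \<not> (fst v \<and> snd v \<in> {1..n} \<and> snd v \<noteq> i)" for i and v :: "bool \<times> nat"
  have "measure_pmf.prob D {v. h i v} = q / p" if i: "i \<in> {1..n}" for i
  proof -
    have "measure_pmf.prob D ({True} \<times> ({1..n} - {i})) = \<beta> * ((real n - 1) / real n)"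
      unfolding D_def using n i \<beta>
      by (subst measure_pmf_prob_product) (auto simp: measure_pmf_single measure_pmf_of_set Int_absorb1 of_nat_diff)
    also have "\<dots> = 1 - q / p"
      using n n1 by (simp add: \<beta>_def)
    finally have "measure_pmf.prob D ({True} \<times> ({1..n} - {i})) = 1 - q / p" .
    moreover have "{v. h i v} = UNIV - {True} \<times> ({1..n} - {i})"
      by (auto simp: h_def)
    ultimately show ?thesis
      using measure_pmf.prob_compl[of "{True} \<times> ({1..n} - {i})" D] by simp
  qed
  moreover have "\<exists>i\<in>{1..n}. h i v" for v
  proof (cases "snd v \<in> {1..n}")
    case True
    then show ?thesis by (intro bexI[of _ "snd v"]) (auto simp: h_def)
  next
    case False
    then show ?thesis using n by (intro bexI[of _ 1]) (auto simp: h_def)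
  qed
  ultimately show ?thesis by (rule that)
qed

text \<open>Only the law of each single code matters for its randomness, so all codes share one
  sample: the coupled choices at common nodes and the same stream of symbols elsewhere.\<close>

lemma random_closed_eq_Inter:
  assumes Q: "random_closed p z Q"
  shows "\<exists>P. (\<forall>i\<in>{1..n}. random_closed q z (P i)) \<and> Q = (\<Inter>i\<in>{1..n}. P i)"
proof -
  define x where "x = code Q"
  have x: "martin_loef_random p z x" "paths (tree x) = Q"
    using Q paths_tree_code unfolding random_closed_def x_def by auto
  obtain D :: "(bool \<times> nat) pmf" and h where
    D: "\<And>i. i \<in> {1..n} \<Longrightarrow> measure_pmf.prob D {v. h i v} = q / p"
    and h: "\<And>v. \<exists>i\<in>{1..n}. h i v"
    by (rule coupling) (rule that)
  let ?M = "iid D \<Otimes>\<^sub>M iid (trit_pmf q)"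
  define y where "y \<omega> i = (\<lambda>j. emit j [True] x (\<lambda>k. h i (fst \<omega> k)) (snd \<omega>))" for \<omega> i
  interpret prob_space ?M
    by (intro prob_space_pair prob_space_iid)
  have "AE \<omega> in ?M. \<forall>i\<in>{1..n}. martin_loef_random q z (y \<omega> i)"
    unfolding y_def using AE_emit_random[OF D x(1)] by (intro AE_finite_allI) auto
  then obtain \<omega> where \<omega>: "\<forall>i\<in>{1..n}. martin_loef_random q z (y \<omega> i)"
    using eventually_happens'[OF ae_filter_bot] by blast
  have "(\<Inter>i\<in>{1..n}. tree (y \<omega> i)) = tree x"
  proof (rule tree_eq_Inter_trees[where s = "\<lambda>i r. h i (fst \<omega> r)"])
    show "y \<omega> i j = widen (x r) (h i (fst \<omega> r))"
      if "run [True] x (y \<omega> i) j = (v, r)" "hd v" for i j v r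
      using emit_run[OF that[unfolded y_def]] by (simp add: y_def)
  qed (rule h)
  moreover have "paths (\<Inter>i\<in>{1..n}. tree (y \<omega> i)) = (\<Inter>i\<in>{1..n}. paths (tree (y \<omega> i)))"
    by (auto simp: paths_def)
  ultimately have "Q = (\<Inter>i\<in>{1..n}. paths (tree (y \<omega> i)))"
    using x(2) by simp
  moreover have "\<forall>i\<in>{1..n}. random_closed q z (paths (tree (y \<omega> i)))"
    using \<omega> by (simp add: random_closed_def paths_tree_in_closed_subsets)
  ultimately show ?thesis
    by (intro exI[of _ "\<lambda>i. paths (tree (y \<omega> i))"]) simp
qed

end

theorem theorem15:
  fixes p :: real and z :: "nat \<Rightarrow> trit" and Q :: "(nat \<Rightarrow> bool) set"
  assumes "0 \<le> p" and "p \<le> 1 / 2" and "computable_real p"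
    and "Q \<in> closed_subsets" and "random_closed p z Q"
  shows "\<forall>n::nat. n \<ge> 2 \<longrightarrow>
    (\<exists>P :: nat \<Rightarrow> (nat \<Rightarrow> bool) set.
      (\<forall>i\<in>{1..n}. P i \<in> closed_subsets \<and> random_closed (1 - root n (1 - p)) z (P i)) \<and>
      Q = (\<Inter>i\<in>{1..n}. P i))"
proof (intro allI impI)
  fix n :: nat assume n: "2 \<le> n"
  show "\<exists>P :: nat \<Rightarrow> (nat \<Rightarrow> bool) set.
      (\<forall>i\<in>{1..n}. P i \<in> closed_subsets \<and> random_closed (1 - root n (1 - p)) z (P i)) \<and>
      Q = (\<Inter>i\<in>{1..n}. P i)"
  \<comment> \<open>At \<open>p = 0\<close> the ratio \<open>q / p\<close> has no meaning as a
    probability, but then the new parameter is again 0 and \<open>n\<close> copies of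
    \<open>Q\<close> serve.\<close>
  proof (cases "p = 0")
    case True
    then have "1 - root n (1 - p) = p" using n by simp
    then show ?thesis
      using assms n by (intro exI[of _ "\<lambda>_. Q"]) auto
  next
    case False
    then interpret root_split p "1 - root n (1 - p)" n
      using assms n by unfold_locales auto
    show ?thesis
      using random_closed_eq_Inter[OF assms(5)] by (simp add: random_closed_def)
  qed
qed

end
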